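(* Let $a,b$ be positive integers, let $\nu=EN^{a-1}E^{b-1}N$, and let $g=\gcd(a,b)$ and $\ell=\operatorname{lcm}(a,b)$. For every increment vector $\delta$ of $\nu$, the orbit structure of rowmotion on the alt hook-Tamari lattice $\mathsf{H}_{\delta}(a,b)$ does not depend on $\delta$. Explicitly, rowmotion on $\mathsf{H}_{\delta}(a,b)$ has exactly $g-1$ orbits of size $\ell$ and exactly one orbit of size $\ell+1$, and it has no other orbits.
   Context: A lattice path is a finite word in the letters $N$ (unit north step) and $E$ (unit east step), drawn starting at the origin; exponents denote repetition. Let $\nu$ be a lattice path with $n$ north steps, written $\nu=E^{\nu_0}NE^{\nu_1}N\cdots NE^{\nu_n}$ with $\nu_i\ge 0$. A $\nu$-path is a lattice path with the same endpoints as $\nu$ that stays weakly above $\nu$. An increment vector of $\nu$ is an integer vector $\delta=(\delta_1,\dots,\delta_n)$ with $0\le\delta_i\le\nu_i$ for all $i$. For a $\nu$-path $\mu$ and a lattice point $x$ on $\mu$, the $\delta$-altitude $\mathrm{alt}_\delta(x)$ is defined recursively along $\mu$. It is $0$ at the initial point. If $x$ is reached from the preceding point $w$ by an $E$ step, then $\mathrm{alt}_\delta(x)=\mathrm{alt}_\delta(w)-1$. If $x$ is reached from $w$ by the $i$th $N$ step of $\mu$, then $\mathrm{alt}_\delta(x)=\mathrm{alt}_\delta(w)+\delta_i$. A $\delta$-rotation is defined as follows. If $\mu$ has a valley $EN$ and $x$ is the point between these two steps, let $y$ be the first lattice point after $x$ on $\mu$ with $\mathrm{alt}_\delta(y)=\mathrm{alt}_\delta(x)$.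 Let $\mu'$ be obtained from $\mu$ by interchanging the subpath of $\mu$ from $x$ to $y$ with the $E$ step immediately preceding $x$. The alt $\nu$-Tamari lattice $\mathrm{Tam}_\delta(\nu)$ is the poset on the set of $\nu$-paths whose cover relations are exactly $\mu\lessdot\mu'$ for all such $\delta$-rotations. It is a finite semidistributive lattice. The alt hook-Tamari lattice is $\mathsf{H}_\delta(a,b)=\mathrm{Tam}_\delta(\nu)$ for $\nu=EN^{a-1}E^{b-1}N$. Rowmotion is defined as follows. A finite lattice $L$ is semidistributive if for all $x\le y$ in $L$ the set $\{z\in L: z\wedge y=x\}$ has a unique maximal element and the set $\{z\in L: z\vee x=y\}$ has a unique minimal element. For $x\in L$ let $\mathrm{Pop}^{\downarrow}(x)=x\wedge\bigwedge\{y\in L: y\lessdot x\}$, where the empty meet is the top element. Rowmotion $\mathrm{Row}:L\to L$ sends $x$ to the unique maximal element of $\{y\in L: x\wedge y=\mathrm{Pop}^{\downarrow}(x)\}$; it is a bijection. The orbit structure means the multiset of sizes of the orbits of $\mathrm{Row}$. *)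

theory Defs
  imports
    "HOL-Library.Multiset"
    "HOL-Algebra.Lattice"
    "HOL-Combinatorics.Orbits"
begin

section \<open>Lattice paths\<close>

datatype step = North | East

definition point :: "step list \<Rightarrow> nat \<Rightarrow> nat \<times> nat" where
  "point \<mu> k = (count_list (take k \<mu>) East, count_list (take k \<mu>) North)"

definition points :: "step list \<Rightarrow> (nat \<times> nat) set" where
  "points \<mu> = point \<mu> ` {0..length \<mu>}"

definition weakly_above :: "step list \<Rightarrow> step list \<Rightarrow> bool" where
  "weakly_above \<mu> \<nu> \<longleftrightarrow> (\<forall>x y. (x, y) \<in> points \<mu> \<longrightarrow> (\<exists>y'\<le>y. (x, y') \<in> points \<nu>))"

definition nu_paths :: "step list \<Rightarrow> step list set" where
  "nu_paths \<nu> = {\<mu>. point \<mu> (length \<mu>) = point \<nu> (length \<nu>) \<and> weakly_above \<mu> \<nu>}"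

text \<open>\<open>east_run \<nu> i\<close> is the exponent $\nu_i$ in $\nu = E^{\nu_0} N E^{\nu_1} N \cdots N E^{\nu_n}$:
  an east step lies in the $i$-th run iff exactly $i$ north steps precede it.\<close>

definition east_run :: "step list \<Rightarrow> nat \<Rightarrow> nat" where
  "east_run \<nu> i = card {k. k < length \<nu> \<and> \<nu> ! k = East \<and> count_list (take k \<nu>) North = i}"

text \<open>An increment vector $(\delta_1,\dots,\delta_n)$ is a function on the naturals of which only
  the values at \<open>1, \<dots>, n\<close> are constrained or ever used.\<close>

definition increment_vector :: "step list \<Rightarrow> (nat \<Rightarrow> int) \<Rightarrow> bool" where
  "increment_vector \<nu> \<delta> \<longleftrightarrow>
     (\<forall>i\<in>{1..count_list \<nu> North}. 0 \<le> \<delta> i \<and> \<delta> i \<le> int (east_run \<nu> i))"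


section \<open>Alt \<open>\<nu>\<close>-Tamari lattices\<close>

text \<open>\<open>alt \<delta> \<mu> k\<close> is the \<open>\<delta>\<close>-altitude of \<open>point \<mu> k\<close>, for \<open>k \<le> length \<mu>\<close>.\<close>

primrec alt :: "(nat \<Rightarrow> int) \<Rightarrow> step list \<Rightarrow> nat \<Rightarrow> int" where
  "alt \<delta> \<mu> 0 = 0"
| "alt \<delta> \<mu> (Suc k) =
     (case \<mu> ! k of
        East \<Rightarrow> alt \<delta> \<mu> k - 1
      | North \<Rightarrow> alt \<delta> \<mu> k + \<delta> (count_list (take (Suc k) \<mu>) North))"

text \<open>The valley point is the \<open>i\<close>-th point, the subpath from it to the first later point of equal
  altitude (the \<open>j\<close>-th) is \<open>North # v\<close>.\<close>

definition rotation :: "(nat \<Rightarrow> int) \<Rightarrow> step list \<Rightarrow> step list \<Rightarrow> bool" where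
  "rotation \<delta> \<mu> \<mu>' \<longleftrightarrow>
     (\<exists>u v w. \<mu> = u @ [East] @ (North # v) @ w \<and> \<mu>' = u @ (North # v) @ [East] @ w \<and>
        (let i = length (u @ [East]); j = length (u @ [East] @ (North # v)) in
           alt \<delta> \<mu> j = alt \<delta> \<mu> i \<and> (\<forall>k. i < k \<and> k < j \<longrightarrow> alt \<delta> \<mu> k \<noteq> alt \<delta> \<mu> i)))"

definition alt_Tamari :: "step list \<Rightarrow> (nat \<Rightarrow> int) \<Rightarrow> step list gorder" where
  "alt_Tamari \<nu> \<delta> =
     \<lparr>carrier = nu_paths \<nu>,
      eq = (=),
      le = (\<lambda>\<mu> \<mu>'. \<mu> \<in> nu_paths \<nu> \<and> \<mu>' \<in> nu_paths \<nu> \<and> rotation \<delta> \<mu> \<mu>')\<^sup>*\<^sup>*\<rparr>"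

definition hook :: "nat \<Rightarrow> nat \<Rightarrow> step list" where
  "hook a b = [East] @ replicate (a - 1) North @ replicate (b - 1) East @ [North]"

definition alt_hook_Tamari :: "(nat \<Rightarrow> int) \<Rightarrow> nat \<Rightarrow> nat \<Rightarrow> step list gorder" where
  "alt_hook_Tamari \<delta> a b = alt_Tamari (hook a b) \<delta>"


section \<open>Rowmotion\<close>

definition covered_by :: "('a, 'b) gorder_scheme \<Rightarrow> 'a \<Rightarrow> 'a \<Rightarrow> bool" where
  "covered_by L y x \<longleftrightarrow> y \<in> carrier L \<and> x \<in> carrier L \<and> y \<sqsubset>\<^bsub>L\<^esub> x \<and>
     \<not> (\<exists>z\<in>carrier L. y \<sqsubset>\<^bsub>L\<^esub> z \<and> z \<sqsubset>\<^bsub>L\<^esub> x)"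

definition maximal_in :: "('a, 'b) gorder_scheme \<Rightarrow> 'a set \<Rightarrow> 'a \<Rightarrow> bool" where
  "maximal_in L S m \<longleftrightarrow> m \<in> S \<and> \<not> (\<exists>z\<in>S. m \<sqsubset>\<^bsub>L\<^esub> z)"

definition pop_down :: "('a, 'b) gorder_scheme \<Rightarrow> 'a \<Rightarrow> 'a" where
  "pop_down L x = x \<sqinter>\<^bsub>L\<^esub> \<Sqinter>\<^bsub>L\<^esub>{y. covered_by L y x}"

text \<open>Meaningful on a finite semidistributive lattice, where the maximal element exists and is
  unique; elsewhere unspecified.\<close>

definition rowmotion :: "('a, 'b) gorder_scheme \<Rightarrow> 'a \<Rightarrow> 'a" where
  "rowmotion L x = (THE m. maximal_in L {y \<in> carrier L. x \<sqinter>\<^bsub>L\<^esub> y = pop_down L x} m)"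

text \<open>\<open>orbit f x\<close> is the set of all $f^n(x)$ with $n > 0$; for a bijection of a finite set this is
  the orbit of \<open>x\<close>.\<close>

definition orbit_structure :: "('a \<Rightarrow> 'a) \<Rightarrow> 'a set \<Rightarrow> nat multiset" where
  "orbit_structure f A = image_mset card (mset_set (orbit f ` A))"

definition row_orbit_structure :: "('a, 'b) gorder_scheme \<Rightarrow> nat multiset" where
  "row_orbit_structure L = orbit_structure (rowmotion L) (carrier L)"

end

theory Submission
  imports Defs "HOL-Library.Product_Order" "HOL-Number_Theory.Cong"
begin

text \<open>A path above the hook is determined by the number \<open>i\<close> of north steps between its first east step
  and height \<open>a - 1\<close> and by the number of east steps before its last north step. Only the increment
  \<open>d = \<delta> (a - 1)\<close> matters, and the lattice is the product of a chain of \<open>a\<close> and a chain of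
  \<open>b\<close> elements with one extra element inserted into the top chain, at a place depending on \<open>d\<close>.
  On the product of chains rowmotion is the rotation $(i, j) \mapsto (i + 1, j + 1)$ of
  $\mathbb{Z}_a \times \mathbb{Z}_b$, whose orbits all have size \<open>lcm a b\<close>. The extra element only
  subdivides one arrow of this rotation, so one orbit grows by one, wherever the element sits.\<close>

section \<open>Rowmotion in coordinates\<close>

text \<open>For \<open>a > 1\<close> the east runs of the hook have lengths 1, 0, ..., 0,
  \<open>b - 1\<close>, 0, so every increment except \<open>\<delta> (a - 1)\<close> is forced to
  vanish, and \<open>d < b\<close>. A path may take at most one east step below height
  \<open>a - 1\<close>. If it takes one (\<open>i > 0\<close>), the last north step has
  \<open>b\<close> places among the \<open>b - 1\<close> other east steps; if it takes none
  (\<open>i = 0\<close>), there are \<open>b + 1\<close> places. This surplus is the extra element.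
  Its place is read off from the rotations that enter row 0. For \<open>i = 1\<close> the first east
  step is pushed past the north step of increment \<open>d\<close> and past \<open>d\<close> east
  steps, and also past the last north step if \<open>j < d\<close>. The number of east steps before
  the last north step thus stays \<open>j\<close> if \<open>j < d\<close> and becomes
  \<open>j + 1\<close> otherwise. The value \<open>d\<close> is never hit, which makes
  \<open>(0, d)\<close> the extra element. Rotations lower the coordinates, so the coordinates carry
  the opposite order and meets become joins. The obstacle is that a componentwise maximum may be a
  missing point \<open>(i, d)\<close> with \<open>i > 0\<close>; correcting it to
  \<open>(i, d + 1)\<close> is what leads rowmotion into the extra element when \<open>a > 1\<close>
  and \<open>d > 0\<close>.\<close>

locale reversed_parametrization =
  fixes L :: "'a gorder" and e :: "'b::order \<Rightarrow> 'a" and M :: "'b set"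
    and j :: "'b \<Rightarrow> 'b \<Rightarrow> 'b" and t :: 'b
  assumes carrier_eq: "carrier L = e ` M"
    and eq_eq: "eq L = (=)"
    and le_iff: "x \<in> M \<Longrightarrow> y \<in> M \<Longrightarrow> le L (e x) (e y) \<longleftrightarrow> y \<le> x"
    and j_closed: "x \<in> M \<Longrightarrow> y \<in> M \<Longrightarrow> j x y \<in> M"
    and j_ge1: "x \<in> M \<Longrightarrow> y \<in> M \<Longrightarrow> x \<le> j x y"
    and j_ge2: "x \<in> M \<Longrightarrow> y \<in> M \<Longrightarrow> y \<le> j x y"
    and j_least: "x \<in> M \<Longrightarrow> y \<in> M \<Longrightarrow> w \<in> M \<Longrightarrow> x \<le> w \<Longrightarrow> y \<le> w \<Longrightarrow> j x y \<le> w"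
    and t_in: "t \<in> M" and t_least: "x \<in> M \<Longrightarrow> t \<le> x"
begin

lemma e_eq_iff: "x \<in> M \<Longrightarrow> y \<in> M \<Longrightarrow> e x = e y \<longleftrightarrow> x = y"
  by (metis le_iff order_antisym order_refl)

lemma lless_iff: "x \<in> M \<Longrightarrow> y \<in> M \<Longrightarrow> e x \<sqsubset>\<^bsub>L\<^esub> e y \<longleftrightarrow> y < x"
  unfolding lless_def eq_eq by (auto simp: le_iff e_eq_iff)

text \<open>Since \<open>e\<close> reverses the order, an infimum in \<open>L\<close> is a least
  upper bound in \<open>M\<close>. Infima are given by a choice operator, so uniqueness is shown as
  well, by antisymmetry on \<open>M\<close>.\<close>

lemma Inf_image:
  assumes S: "S \<subseteq> M" and z: "z \<in> M" and ub: "\<forall>s\<in>S. s \<le> z"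
    and least: "\<forall>w\<in>M. (\<forall>s\<in>S. s \<le> w) \<longrightarrow> z \<le> w"
  shows "\<Sqinter>\<^bsub>L\<^esub>(e ` S) = e z"
  unfolding inf_def
proof (rule some_equality)
  have low: "e w \<in> Lower L (e ` S) \<longleftrightarrow> (\<forall>s\<in>S. s \<le> w)" if "w \<in> M" for w
  proof -
    have *: "e ` S \<inter> e ` M = e ` S" using S by blast
    have "e w \<in> Lower L (e ` S) \<longleftrightarrow> (\<forall>s\<in>S. le L (e w) (e s))"
      unfolding Lower_def carrier_eq * using that by blast
    then show ?thesis using that S le_iff by blast
  qed
  have sub: "Lower L (e ` S) \<subseteq> e ` M"
    unfolding Lower_def carrier_eq by auto
  show *: "greatest L (e z) (Lower L (e ` S))"
    unfolding greatest_def carrier_eq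
  proof (intro conjI ballI)
    show "Lower L (e ` S) \<subseteq> e ` M" by (rule sub)
    show "e z \<in> Lower L (e ` S)" using low[OF z] ub by blast
    fix g assume "g \<in> Lower L (e ` S)"
    moreover then obtain w where "w \<in> M" "g = e w" using sub by blast
    ultimately show "le L g (e z)" using low le_iff z least by metis
  qed
  fix g assume g: "greatest L g (Lower L (e ` S))"
  have in_Lower: "h \<in> Lower L (e ` S)" and above: "\<forall>x\<in>Lower L (e ` S). le L x h"
    if "greatest L h (Lower L (e ` S))" for h
    using that unfolding greatest_def by simp_all
  obtain w where w: "w \<in> M" "g = e w" using in_Lower[OF g] sub by blast
  have "le L (e w) (e z)" "le L (e z) (e w)"
    using in_Lower[OF g] above[OF g] in_Lower[OF *] above[OF *] w by simp_all
  then show "g = e z" using w z by (simp add: le_iff)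
qed

lemma meet_image: "x \<in> M \<Longrightarrow> y \<in> M \<Longrightarrow> e x \<sqinter>\<^bsub>L\<^esub> e y = e (j x y)"
  using Inf_image[of "{x, y}" "j x y"] j_closed j_ge1 j_ge2 j_least
  unfolding meet_def by auto

text \<open>An antichain above \<open>x\<close> such that everything above \<open>x\<close>
  dominates one of its members consists of the minimal elements above \<open>x\<close>; in
  \<open>L\<close> these are the lower covers.\<close>

lemma covered_by_image:
  assumes x: "x \<in> M" and C: "C \<subseteq> M" and above: "\<forall>c\<in>C. x < c"
    and cof: "\<forall>y\<in>M. x < y \<longrightarrow> (\<exists>c\<in>C. c \<le> y)"
    and anti: "\<forall>c\<in>C. \<forall>c'\<in>C. c \<le> c' \<longrightarrow> c = c'"
  shows "{y. covered_by L y (e x)} = e ` C"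
proof -
  have "covered_by L (e y) (e x) \<longleftrightarrow> y \<in> C" if y: "y \<in> M" for y
  proof -
    have "covered_by L (e y) (e x) \<longleftrightarrow> x < y \<and> \<not> (\<exists>z\<in>M. z < y \<and> x < z)"
      unfolding covered_by_def carrier_eq using x y by (auto simp: lless_iff)
    also have "\<dots> \<longleftrightarrow> y \<in> C"
    proof
      assume *: "x < y \<and> \<not> (\<exists>z\<in>M. z < y \<and> x < z)"
      then obtain c where "c \<in> C" "c \<le> y" using cof y by blast
      then show "y \<in> C" using * above C by (metis order_le_less subsetD)
    next
      assume yC: "y \<in> C"
      have False if z: "z \<in> M" "z < y" "x < z" for z
      proof -
        obtain c where "c \<in> C" "c \<le> z" using cof z by blast
        then show False using anti yC z by (metis leD order_le_less_trans order_less_imp_le)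
      qed
      then show "x < y \<and> \<not> (\<exists>z\<in>M. z < y \<and> x < z)" using above yC by blast
    qed
    finally show ?thesis .
  qed
  moreover have "y \<in> e ` M" if "covered_by L y (e x)" for y
    using that unfolding covered_by_def carrier_eq by blast
  ultimately show ?thesis using C by blast
qed

text \<open>Turns rowmotion into order conditions on coordinates: \<open>C\<close> collects the
  covers, \<open>p\<close> is the join of \<open>x\<close> and \<open>C\<close>, and
  \<open>r\<close> is the least solution of \<open>j x y = p\<close>. In \<open>L\<close> a least
  solution becomes a greatest one, hence the only maximal one.\<close>

lemma rowmotion_eqI:
  assumes x: "x \<in> M" and C: "C \<subseteq> M" "\<forall>c\<in>C. x < c"
      "\<forall>y\<in>M. x < y \<longrightarrow> (\<exists>c\<in>C. c \<le> y)"
      "\<forall>c\<in>C. \<forall>c'\<in>C. c \<le> c' \<longrightarrow> c = c'"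
    and p: "p \<in> M" "x \<le> p" "\<forall>c\<in>C. c \<le> p"
      "\<forall>w\<in>M. x \<le> w \<longrightarrow> (\<forall>c\<in>C. c \<le> w) \<longrightarrow> p \<le> w"
    and r: "r \<in> M" "j x r = p" "\<forall>y\<in>M. j x y = p \<longrightarrow> r \<le> y"
  shows "rowmotion L (e x) = e r"
proof -
  have pop: "pop_down L (e x) = e p"
  proof (cases "C = {}")
    \<comment> \<open>Without covers, \<open>e x\<close> is the bottom of the lattice, and the empty
      meet is the top \<open>e t\<close>.\<close>
    case True
    have "\<Sqinter>\<^bsub>L\<^esub>{} = e t" using Inf_image[of "{}" t] t_in t_least by simp
    moreover have "p = x" using True p x by (simp add: order_antisym)
    moreover have "j x t = x"
      using j_ge1[OF x t_in] j_least[OF x t_in x order_refl t_least[OF x]] by order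
    ultimately show ?thesis
      unfolding pop_down_def covered_by_image[OF x C] using True x t_in by (simp add: meet_image)
  next
    case False
    then obtain c where c: "c \<in> C" by blast
    \<comment> \<open>The bound \<open>x \<le> w\<close> demanded by the minimality of
      \<open>p\<close> follows from \<open>x < c\<close> for any single cover
      \<open>c\<close>.\<close>
    have "\<forall>w\<in>M. (\<forall>s\<in>C. s \<le> w) \<longrightarrow> p \<le> w"
      using c C(2) p(4) by (meson order_less_imp_le order_trans)
    then have "\<Sqinter>\<^bsub>L\<^esub>(e ` C) = e p" using Inf_image[of C p] C(1) p by blast
    moreover have "j x p = p"
      using j_ge2[OF x p(1)] j_least[OF x p(1) p(1) p(2) order_refl] by order
    ultimately show ?thesis
      unfolding pop_down_def covered_by_image[OF x C] using x p by (simp add: meet_image)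
  qed
  define S where "S = {y \<in> carrier L. e x \<sqinter>\<^bsub>L\<^esub> y = pop_down L (e x)}"
  have S: "S = e ` {y \<in> M. j x y = p}"
    unfolding S_def pop carrier_eq using x p(1) j_closed by (auto simp: meet_image e_eq_iff)
  show ?thesis
    unfolding rowmotion_def S_def[symmetric]
  proof (rule the_equality)
    show "maximal_in L S (e r)"
      unfolding maximal_in_def S using r by (auto simp: lless_iff)
    fix n assume n: "maximal_in L S n"
    then obtain y where y: "n = e y" "y \<in> M" "j x y = p" unfolding maximal_in_def S by blast
    have "\<not> e y \<sqsubset>\<^bsub>L\<^esub> e r" using n r unfolding y(1) maximal_in_def S by blast
    then show "n = e r" using r y by (auto simp: lless_iff le_less)
  qed
qed

end


section \<open>Orbit structure\<close>

lemma orbit_image: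
  assumes "x \<in> A" and closed: "g ` A \<subseteq> A" and conj: "\<forall>y\<in>A. f (e y) = e (g y)"
  shows "orbit f (e x) = e ` orbit g x" and "orbit g x \<subseteq> A"
proof -
  have pow: "(g ^^ n) x \<in> A \<and> (f ^^ n) (e x) = e ((g ^^ n) x)" for n
    by (induction n) (use assms in auto)
  then show "orbit f (e x) = e ` orbit g x" "orbit g x \<subseteq> A"
    unfolding orbit_altdef by auto
qed

lemma orbit_structure_image:
  assumes "inj_on e A" and "g ` A \<subseteq> A" and "\<forall>y\<in>A. f (e y) = e (g y)"
  shows "orbit_structure f (e ` A) = orbit_structure g A"
proof -
  have sub: "orbit g ` A \<subseteq> Pow A" using orbit_image(2)[OF _ assms(2,3)] by blast
  have "orbit f ` e ` A = (`) e ` orbit g ` A"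
    using orbit_image(1)[OF _ assms(2,3)] by (auto simp: image_image)
  moreover have "inj_on ((`) e) (orbit g ` A)"
    using inj_on_image_Pow[OF assms(1)] sub by (rule inj_on_subset)
  ultimately have "mset_set (orbit f ` e ` A) = image_mset ((`) e) (mset_set (orbit g ` A))"
    by (simp add: image_mset_mset_set)
  moreover have "image_mset card (image_mset ((`) e) (mset_set (orbit g ` A)))
    = image_mset card (mset_set (orbit g ` A))"
    unfolding multiset.map_comp
  proof (rule image_mset_cong)
    fix S assume "S \<in># mset_set (orbit g ` A)"
    \<comment> \<open>The case distinction is due to \<open>mset_set\<close> being empty on infinite
      sets.\<close>
    then have "S \<in> orbit g ` A"
      by (cases "finite (orbit g ` A)") simp_all
    then have "inj_on e S" using sub inj_on_subset[OF assms(1)] by blast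
    then show "(card \<circ> (`) e) S = card S" by (simp add: card_image)
  qed
  ultimately show ?thesis unfolding orbit_structure_def by simp
qed

text \<open>The orbits partition \<open>A\<close>, so counting elements determines how many have size \<open>l\<close>.\<close>

lemma orbit_structure_one_exception:
  assumes fin: "finite A" and closed: "f ` A \<subseteq> A"
    and self: "\<forall>x\<in>A. x \<in> orbit f x" and s: "s \<in> A" and card_s: "card (orbit f s) = Suc l"
    and card_x: "\<forall>x\<in>A. x \<notin> orbit f s \<longrightarrow> card (orbit f x) = l"
    and l: "l > 0" and card_A: "card A = g * l + 1"
  shows "orbit_structure f A = replicate_mset (g - 1) l + {#l + 1#}"
proof -
  have sub: "orbit f x \<subseteq> A" if "x \<in> A" for x
    using orbit_image(2)[of x A f f id] that closed by simp
  \<comment> \<open>Every point lies in its own orbit, which makes lying in an orbit a symmetric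
    relation; the orbits are then equivalence classes.\<close>
  have eq: "orbit f x = orbit f y" if "y \<in> orbit f x" "x \<in> A" for x y
    using that self by (metis orbit_swap orbit_trans subsetI subset_antisym)
  have disj: "orbit f x = orbit f y" if "z \<in> orbit f x" "z \<in> orbit f y" "x \<in> A" "y \<in> A" for x y z
    using that eq by metis
  define B where "B = orbit f ` A - {orbit f s}"
  have B: "orbit f ` A = insert (orbit f s) B" "orbit f s \<notin> B" "finite B"
    unfolding B_def using s fin by auto
  have cB: "card S = l" if S: "S \<in> B" for S
  proof -
    obtain x where x: "x \<in> A" "S = orbit f x" "orbit f x \<noteq> orbit f s" using S unfolding B_def by blast
    then have "x \<notin> orbit f s" using eq s by metis
    then show ?thesis using x card_x by blast
  qed
  have "A = \<Union> (orbit f ` A)" using self sub by blast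
  then have "card A = card (\<Union> (orbit f ` A))" by simp
  also have "\<dots> = sum card (orbit f ` A)"
    by (rule card_Union_disjoint) (auto simp: pairwise_def disjnt_def intro: finite_subset[OF sub fin] dest: disj)
  also have "\<dots> = Suc l + card B * l"
    using B card_s cB by simp
  finally have "g * l + 1 = (Suc (card B)) * l + 1" using card_A by simp
  then have "card B = g - 1" using l by (metis add_right_imp_eq diff_Suc_1 mult_right_cancel not_gr0)
  moreover have "image_mset card (mset_set B) = replicate_mset (card B) l"
  proof -
    have "image_mset card (mset_set B) = image_mset (\<lambda>_. l) (mset_set B)"
      using cB B(3) by (intro image_mset_cong) simp
    then show ?thesis by (simp add: image_mset_const_eq)
  qed
  ultimately show ?thesis
    unfolding orbit_structure_def B(1) using B card_s by simp
qed

text \<open>An orbit is computed by exhibiting an enumeration \<open>s\<close> of it with exact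
  period \<open>l\<close>; any \<open>l\<close> consecutive terms then list it without
  repetition.\<close>

lemma card_orbit_periodic:
  assumes step: "\<And>n. f (s n) = s (Suc n)" and per: "\<And>n k. s n = s k \<longleftrightarrow> [n = k] (mod l)"
    and l: "l > (0::nat)"
  shows "s k \<in> orbit f (s n)" "card (orbit f (s n)) = l"
proof -
  have pow: "(f ^^ k) (s n) = s (n + k)" for k by (induction k) (auto simp: step)
  have orb: "orbit f (s n) = s ` {n..<n + l}"
  proof (intro equalityI subsetI)
    fix y assume "y \<in> orbit f (s n)"
    then obtain k where "y = s (n + k)" unfolding orbit_altdef pow by blast
    also have "\<dots> = s (n + k mod l)" unfolding per cong_def by (simp add: mod_simps)
    finally show "y \<in> s ` {n..<n + l}" using l by simp
  next
    fix y assume "y \<in> s ` {n..<n + l}"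
    then obtain k where "y = s k" "n \<le> k" by auto
    \<comment> \<open>A full period is added because \<open>orbit\<close> contains only positive
      iterates, and \<open>k = n\<close> is possible.\<close>
    moreover have "s k = s (n + (k - n + l))" unfolding per cong_def using \<open>n \<le> k\<close> by simp
    ultimately show "y \<in> orbit f (s n)" unfolding orbit_altdef pow using l by blast
  qed
  \<comment> \<open>Enough periods are added to \<open>k\<close> to move it beyond \<open>n\<close>,
    so that it is reached by a positive iterate.\<close>
  have "n < k + l * Suc n" using l by (cases l) simp_all
  then obtain m where "k + l * Suc n = n + m" "m > 0" by (metis less_imp_add_positive)
  moreover have "s k = s (k + l * Suc n)" unfolding per by (simp add: cong_def mod_add_right_eq[symmetric] del: mult_Suc_right)
  ultimately show "s k \<in> orbit f (s n)" unfolding orbit_altdef pow by auto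
  have "inj_on s {n..<n + l}"
  proof (rule inj_onI)
    fix x y assume xy: "x \<in> {n..<n + l}" "y \<in> {n..<n + l}" "s x = s y"
    then have "[x - n = y - n] (mod l)"
      using per[of x y] by (metis add_diff_inverse_nat atLeastLessThan_iff cong_add_lcancel_nat leD)
    then have "x - n = y - n" using xy by (auto intro: cong_less_modulus_unique_nat)
    then show "x = y" using xy by (simp add: eq_diff_iff)
  qed
  then show "card (orbit f (s n)) = l" unfolding orb by (simp add: card_image)
qed


text \<open>\<open>None\<close> is the extra element, inserted just before \<open>(0, d)\<close> in its orbit.\<close>

definition grid_row :: "nat \<Rightarrow> nat \<Rightarrow> nat \<Rightarrow> (nat \<times> nat) option \<Rightarrow> (nat \<times> nat) option" where
  "grid_row a b d x = (case x of
     None \<Rightarrow> Some (0, d)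
   | Some (i, j) \<Rightarrow>
       if Suc i = a \<and> Suc j mod b = d then None else Some (Suc i mod a, Suc j mod b))"

definition grid :: "nat \<Rightarrow> nat \<Rightarrow> (nat \<times> nat) option set" where
  "grid a b = insert None (Some ` ({..<a} \<times> {..<b}))"

lemma grid_row_closed:
  assumes "a > 0" "b > 0" "d < b"
  shows "grid_row a b d ` grid a b \<subseteq> grid a b"
proof -
  have "grid_row a b d x \<in> grid a b" for x
    unfolding grid_row_def grid_def using assms by (simp add: image_iff split: option.split)
  then show ?thesis by blast
qed

section \<open>Orbit lengths of the diagonal rotation with one subdivided arrow\<close>

lemma cong_lcm_iff_nat: "[n = k] (mod lcm a b) \<longleftrightarrow> [n = k] (mod a) \<and> [n = k] (mod (b::nat))"
proof -
  have "[int n = int k] (mod int m) \<longleftrightarrow> int m dvd int n - int k" for m by (rule cong_iff_dvd_diff)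
  then have *: "[n = k] (mod m) \<longleftrightarrow> int m dvd int n - int k" for m using cong_int_iff by blast
  show ?thesis unfolding * by (simp flip: lcm_int_int_eq)
qed

text \<open>Translation by \<open>(1, 1)\<close> on the torus returns to its start exactly at the
  common multiples of \<open>a\<close> and \<open>b\<close>, from any starting point.\<close>

lemma grid_pair_eq_iff:
  "((i + n) mod a, (j + n) mod b) = ((i + k) mod a, (j + k) mod b) \<longleftrightarrow> [n = k] (mod lcm a (b::nat))"
  unfolding cong_lcm_iff_nat prod.inject cong_def[symmetric] by (simp add: cong_add_lcancel_nat)

text \<open>The orbit of \<open>None\<close> is one full lap of the diagonal through
  \<open>(0, d)\<close>, closed up by \<open>None\<close>. The last claim, for arbitrary
  \<open>k\<close>, says that this whole diagonal is absorbed.\<close>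

lemma orbit_grid_row_None:
  assumes "a > 0" "b > 0" "d < b"
  shows "None \<in> orbit (grid_row a b d) None"
    and "card (orbit (grid_row a b d) None) = Suc (lcm a b)"
    and "Some (k mod a, (d + k) mod b) \<in> orbit (grid_row a b d) None"
proof -
  define l where "l = lcm a b"
  have l: "l > 0" unfolding l_def using assms by (simp add: lcm_pos_nat)
  \<comment> \<open>One lap has \<open>Suc l\<close> terms: residue 0 is \<open>None\<close>,
    residue \<open>Suc k\<close> is the point \<open>k\<close> steps after
    \<open>(0, d)\<close>.\<close>
  define s where "s n = (case n mod Suc l of 0 \<Rightarrow> None | Suc k \<Rightarrow> Some (k mod a, (d + k) mod b))" for n
  have step: "grid_row a b d (s n) = s (Suc n)" for n
  proof (cases "n mod Suc l")
    case 0
    then have "Suc n mod Suc l = Suc 0" using l by (simp add: mod_Suc)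
    then show ?thesis using 0 assms unfolding s_def grid_row_def by simp
  next
    case (Suc k)
    have kl: "k < l" using Suc mod_less_divisor[of "Suc l" n] by linarith
    have "Suc (k mod a) = a \<longleftrightarrow> Suc k mod a = 0" using assms by (simp add: mod_Suc)
    moreover have "Suc ((d + k) mod b) mod b = d \<longleftrightarrow> Suc k mod b = 0"
    proof -
      have "Suc ((d + k) mod b) mod b = d \<longleftrightarrow> [d + Suc k = d + 0] (mod b)"
        unfolding cong_def using assms by (simp add: mod_Suc_eq)
      then show ?thesis unfolding cong_add_lcancel_nat by (simp add: cong_def)
    qed
    \<comment> \<open>The subdivided arrow is the one whose head would be \<open>(0, d)\<close>, so
      on this diagonal it is met exactly when \<open>a\<close> and \<open>b\<close> both divide
      \<open>Suc k\<close>, that is, at the end of a lap.\<close>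
    ultimately have exc: "Suc (k mod a) = a \<and> Suc ((d + k) mod b) mod b = d \<longleftrightarrow> l dvd Suc k"
      unfolding l_def by (simp add: mod_eq_0_iff_dvd)
    show ?thesis
    proof (cases "Suc k = l")
      case True
      then have "Suc n mod Suc l = 0" using Suc by (simp add: mod_Suc)
      then have "s (Suc n) = None" unfolding s_def by simp
      moreover have "s n = Some (k mod a, (d + k) mod b)" unfolding s_def Suc by simp
      moreover have "Suc (k mod a) = a \<and> Suc ((d + k) mod b) mod b = d" using exc True by simp
      ultimately show ?thesis unfolding grid_row_def by simp
    next
      case False
      then have "\<not> l dvd Suc k" using kl by (auto dest: dvd_imp_le)
      moreover have "Suc n mod Suc l = Suc (Suc k)" using Suc False by (simp add: mod_Suc)
      ultimately show ?thesis using Suc exc unfolding s_def grid_row_def by (simp add: mod_Suc_eq)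
    qed
  qed
  have per: "s n = s k \<longleftrightarrow> [n = k] (mod Suc l)" for n k
  proof -
    have pair: "(x mod a, (d + x) mod b) = (y mod a, (d + y) mod b) \<longleftrightarrow> x = y"
      if "x < l" "y < l" for x y
      using grid_pair_eq_iff[of 0 x a d b y] that cong_less_modulus_unique_nat[of x y l]
      unfolding l_def by auto
    have "n mod Suc l < Suc l" "k mod Suc l < Suc l" by simp_all
    then show ?thesis
      unfolding s_def cong_def by (cases "n mod Suc l"; cases "k mod Suc l") (simp_all only: nat.case option.inject option.distinct nat.distinct nat.inject Suc_less_eq pair simp_thms)
  qed
  have s0: "s 0 = None" unfolding s_def by simp
  note P = card_orbit_periodic[of "grid_row a b d" s "Suc l", OF step per]
  show "None \<in> orbit (grid_row a b d) None" using P(1)[of 0 0] s0 by simp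
  show "card (orbit (grid_row a b d) None) = Suc (lcm a b)" using P(2)[of 0] s0 l_def by simp
  have "s (Suc (k mod l)) = Some (k mod l mod a, (d + k mod l) mod b)"
    unfolding s_def using l by simp
  also have "\<dots> = Some (k mod a, (d + k) mod b)"
    using grid_pair_eq_iff[of 0 "k mod l" a d b k] unfolding l_def by simp
  finally show "Some (k mod a, (d + k) mod b) \<in> orbit (grid_row a b d) None"
    using P(1)[of "Suc (k mod l)" 0] s0 by simp
qed

text \<open>Only the diagonal through \<open>(0, d)\<close> contains the subdivided arrow; elsewhere
  \<open>grid_row\<close> is the plain rotation.\<close>

lemma orbit_grid_row_Some:
  assumes "a > 0" "b > 0" "d < b" and x: "x \<in> grid a b" "x \<notin> orbit (grid_row a b d) None"
  shows "x \<in> orbit (grid_row a b d) x" and "card (orbit (grid_row a b d) x) = lcm a b"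
proof -
  obtain i j where ij: "x = Some (i, j)" "i < a" "j < b"
    using x orbit_grid_row_None(1)[OF assms(1-3)] unfolding grid_def by auto
  define s where "s n = Some ((i + n) mod a, (j + n) mod b)" for n
  have step: "grid_row a b d (s n) = s (Suc n)" for n
  proof -
    have False if 1: "Suc ((i + n) mod a) = a" and 2: "Suc ((j + n) mod b) mod b = d"
    proof -
      \<comment> \<open>This \<open>k\<close> represents \<open>- Suc n\<close> modulo both
        \<open>a\<close> and \<open>b\<close>. If \<open>x\<close> reached \<open>(0, d)\<close>
        after \<open>Suc n\<close> steps, then \<open>x\<close> would be the point \<open>k\<close>
        steps after \<open>(0, d)\<close>, hence in the orbit of \<open>None\<close>.\<close>
      define k where "k = (lcm a b - 1) * Suc n"
      have k: "k + Suc n = lcm a b * Suc n"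
        unfolding k_def using assms(1,2)
        by (metis Suc_diff_1 add.commute lcm_pos_nat mult_Suc)
      have "[i + Suc n = 0] (mod a)" using 1 unfolding cong_def by (metis add_Suc_right mod_Suc_eq mod_0 mod_self)
      then have "[i + Suc n + k = 0 + k] (mod a)" by (rule cong_add) simp
      moreover have "[i + (k + Suc n) = i + 0] (mod a)"
        unfolding k cong_add_lcancel_nat by (simp add: cong_0_iff dvd_mult2)
      ultimately have "[i = k] (mod a)" by (metis add.assoc add.commute add_0 add_0_right cong_sym cong_trans)
      moreover have "[j + Suc n = d] (mod b)" using 2 assms(3) unfolding cong_def by (simp add: mod_Suc_eq)
      then have "[j + Suc n + k = d + k] (mod b)" by (rule cong_add) simp
      moreover have "[j + (k + Suc n) = j + 0] (mod b)"
        unfolding k cong_add_lcancel_nat by (simp add: cong_0_iff dvd_mult2)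
      ultimately have "i mod a = k mod a" "j mod b = (d + k) mod b"
        by (metis cong_def, metis add.assoc add.commute add_0_right cong_def)
      then have "x = Some (k mod a, (d + k) mod b)" using ij by simp
      then show False using x orbit_grid_row_None(3)[OF assms(1-3)] by metis
    qed
    then show ?thesis unfolding s_def grid_row_def by (auto simp: mod_Suc_eq)
  qed
  have per: "s n = s k \<longleftrightarrow> [n = k] (mod lcm a b)" for n k
    unfolding s_def option.inject by (rule grid_pair_eq_iff)
  have s0: "s 0 = x" unfolding s_def using ij by simp
  have l: "lcm a b > 0" using assms by (simp add: lcm_pos_nat)
  note P = card_orbit_periodic[of "grid_row a b d" s "lcm a b", OF step per l]
  show "x \<in> orbit (grid_row a b d) x" "card (orbit (grid_row a b d) x) = lcm a b"
    using P(1)[of 0 0] P(2)[of 0] s0 by simp_all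
qed

lemma orbit_structure_grid_row:
  assumes "a > 0" "b > 0" "d < b"
  shows "orbit_structure (grid_row a b d) (grid a b) =
    replicate_mset (gcd a b - 1) (lcm a b) + {#lcm a b + 1#}"
proof (rule orbit_structure_one_exception[where s = None])
  show "card (grid a b) = gcd a b * lcm a b + 1"
    unfolding grid_def by (simp add: card_image prod_gcd_lcm_nat[symmetric])
  show "grid_row a b d ` grid a b \<subseteq> grid a b" using assms by (rule grid_row_closed)
  show "\<forall>x\<in>grid a b. x \<in> orbit (grid_row a b d) x"
    using orbit_grid_row_Some(1)[OF assms] self_in_orbit_trans[OF orbit_grid_row_None(1)[OF assms]]
    by blast
  show "lcm a b > 0" using assms by (simp add: lcm_pos_nat)
  show "finite (grid a b)" "None \<in> grid a b" unfolding grid_def by simp_all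
  show "card (orbit (grid_row a b d) None) = Suc (lcm a b)"
    using assms by (rule orbit_grid_row_None)
  show "\<forall>x\<in>grid a b. x \<notin> orbit (grid_row a b d) None \<longrightarrow> card (orbit (grid_row a b d) x) = lcm a b"
    using orbit_grid_row_Some(2)[OF assms] by blast
qed

section \<open>The product of chains with an extra element\<close>

text \<open>In every row but row \<open>0\<close> the coordinate \<open>d\<close> is left out; with this shift the order becomes
  componentwise. Coordinates are reversed: \<open>(0, 0)\<close> is the top of the lattice.\<close>

definition model :: "nat \<Rightarrow> nat \<Rightarrow> nat \<Rightarrow> (nat \<times> nat) set" where
  "model a b d = {(i, r). i < a \<and> r \<le> b \<and> (r = d \<longrightarrow> i = 0)}"

text \<open>The componentwise maximum, moved to the next coordinate when it would be one of the
  points left out.\<close>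

definition model_join :: "nat \<Rightarrow> nat \<times> nat \<Rightarrow> nat \<times> nat \<Rightarrow> nat \<times> nat" where
  "model_join d x y = (max (fst x) (fst y),
     if max (snd x) (snd y) = d \<and> max (fst x) (fst y) > 0 then Suc d else max (snd x) (snd y))"

text \<open>The increasing enumeration of the natural numbers other than \<open>d\<close>.\<close>

definition skip :: "nat \<Rightarrow> nat \<Rightarrow> nat" where
  "skip d j = (if j < d then j else Suc j)"

definition model_of_grid :: "nat \<Rightarrow> (nat \<times> nat) option \<Rightarrow> nat \<times> nat" where
  "model_of_grid d x = (case x of None \<Rightarrow> (0, d) | Some (i, j) \<Rightarrow> (i, skip d j))"

lemma model_of_grid_image:
  assumes "a > 0" "d < b"
  shows "model_of_grid d ` grid a b = model a b d"
proof (intro equalityI subsetI)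
  fix x assume "x \<in> model_of_grid d ` grid a b"
  then show "x \<in> model a b d"
    using assms unfolding model_of_grid_def grid_def model_def skip_def by (auto split: if_splits)
next
  fix x assume x: "x \<in> model a b d"
  obtain i r where ir: "x = (i, r)" by (cases x)
  show "x \<in> model_of_grid d ` grid a b"
  proof (cases "r = d")
    case True
    then show ?thesis
      using x unfolding ir model_def grid_def model_of_grid_def by auto
  next
    case False
    define j where "j = (if r < d then r else r - 1)"
    have "skip d j = r" "j < b" "i < a"
      using x False assms unfolding ir model_def skip_def j_def by auto
    then show ?thesis
      unfolding ir grid_def model_of_grid_def by (intro image_eqI[where x = "Some (i, j)"]) auto
  qed
qed

lemma inj_on_model_of_grid: "inj_on (model_of_grid d) A"
  by (rule inj_onI) (auto simp: model_of_grid_def skip_def split: option.splits if_splits)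

section \<open>Rowmotion on the model, point by point\<close>

locale hook_lattice =
  reversed_parametrization L e "model a b d" "model_join d" "(0, 0)"
  for L :: "'a gorder" and e and a b d +
  assumes b_pos: "b > 0" and d_less: "d < b"
begin

lemma a_pos: "a > 0"
  using t_in unfolding model_def by simp

lemmas model_simps = model_def model_join_def less_eq_prod_def less_prod_def max_def

lemma row_bottom: "rowmotion L (e (a - 1, b)) = e (0, 0)"
  by (rule rowmotion_eqI[where C = "{}" and p = "(a - 1, b)"])
    (use a_pos b_pos d_less in \<open>auto simp: model_simps\<close>)

text \<open>The least point whose join with \<open>(a - 1, r)\<close> is the cover
  \<open>(a - 1, n)\<close> lies in row 0. If \<open>Suc r = d\<close> and \<open>a > 1\<close>, the
  maximum \<open>(a - 1, d)\<close> is missing and is corrected to \<open>(a - 1, d + 1)\<close>, so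
  \<open>(0, d)\<close> already suffices: here the orbit enters the extra element.\<close>

lemma row_last:
  assumes "(a - 1, r) \<in> model a b d" "r < b"
  shows "rowmotion L (e (a - 1, r)) = e (0, Suc r)"
proof -
  define n where "n = (if a > 1 \<and> Suc r = d then Suc (Suc r) else Suc r)"
  show ?thesis
    by (rule rowmotion_eqI[where C = "{(a - 1, n)}" and p = "(a - 1, n)"])
      (use assms a_pos b_pos d_less in \<open>auto simp: model_simps n_def split: if_splits\<close>)
qed

text \<open>Every later row omits \<open>d\<close>, so a point above \<open>(0, d)\<close> other
  than itself is already above \<open>(0, Suc d)\<close>. Hence there is a single cover, and only it
  and nothing smaller joins to it.\<close>

lemma row_extra: "rowmotion L (e (0, d)) = e (0, Suc d)"
  by (rule rowmotion_eqI[where C = "{(0, Suc d)}" and p = "(0, Suc d)"])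
    (use a_pos b_pos d_less in \<open>auto simp: model_simps split: if_splits\<close>)

text \<open>The image is the least point of row \<open>Suc i\<close>, whose second coordinate is 1
  rather than 0 if \<open>d = 0\<close>.\<close>

lemma row_right:
  assumes "Suc i < a"
  shows "rowmotion L (e (i, b)) = e (Suc i, skip d 0)"
  by (rule rowmotion_eqI[where C = "{(Suc i, b)}" and p = "(Suc i, b)"])
    (use assms b_pos d_less in \<open>auto simp: model_simps skip_def split: if_splits\<close>)

lemma row_inner:
  assumes "Suc i < a" "Suc j < b"
  shows "rowmotion L (e (i, skip d j)) = e (Suc i, skip d (Suc j))"
proof -
  \<comment> \<open>The successor within row \<open>i\<close>; only row 0 contains \<open>d\<close>.
    If \<open>n = d\<close> there, the join of the two covers is corrected from \<open>d\<close> to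
    \<open>Suc d\<close>, which again gives \<open>skip d (Suc j)\<close>.\<close>
  define n where "n = (if i > 0 then skip d (Suc j) else Suc (skip d j))"
  show ?thesis
    by (rule rowmotion_eqI[where C = "{(Suc i, skip d j), (i, n)}" and p = "(Suc i, skip d (Suc j))"])
      (use assms b_pos d_less in \<open>auto simp: model_simps n_def skip_def split: if_splits\<close>)
qed

lemma row_model_of_grid:
  assumes "x \<in> grid a b"
  shows "rowmotion L (e (model_of_grid d x)) = e (model_of_grid d (grid_row a b d x))"
proof (cases x)
  case None
  then show ?thesis using row_extra unfolding model_of_grid_def grid_row_def skip_def by simp
next
  case (Some ij)
  then obtain i j where ij: "x = Some (i, j)" "i < a" "j < b" using assms unfolding grid_def by auto
  have mem: "(i, skip d j) \<in> model a b d" using ij d_less unfolding model_def skip_def by auto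
  consider "Suc i = a" "Suc j = b" | "Suc i = a" "Suc j < b" | "Suc i < a" "Suc j = b"
    | "Suc i < a" "Suc j < b" using ij by linarith
  then show ?thesis
  proof cases
    case 1
    \<comment> \<open>The bottom goes to the top \<open>(0, 0)\<close>, which is the extra element
      if \<open>d = 0\<close> and the grid point \<open>(0, 0)\<close> otherwise.\<close>
    then have "i = a - 1" "skip d j = b" using d_less unfolding skip_def by auto
    then show ?thesis using 1 ij row_bottom unfolding model_of_grid_def grid_row_def skip_def by simp
  next
    case 2
    have *: "skip d j < b" using 2 unfolding skip_def by auto
    have "i = a - 1" using 2 by simp
    then have "rowmotion L (e (i, skip d j)) = e (0, Suc (skip d j))" using row_last mem * by simp
    then show ?thesis using 2 ij unfolding model_of_grid_def grid_row_def skip_def by auto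
  next
    case 3
    then have "skip d j = b" using d_less unfolding skip_def by auto
    then show ?thesis using 3 ij row_right unfolding model_of_grid_def grid_row_def by simp
  next
    case 4
    then show ?thesis using ij row_inner unfolding model_of_grid_def grid_row_def by simp
  qed
qed

lemma row_orbit_structure_eq:
  "row_orbit_structure L = replicate_mset (gcd a b - 1) (lcm a b) + {#lcm a b + 1#}"
proof -
  have img: "model_of_grid d ` grid a b = model a b d" using a_pos d_less by (rule model_of_grid_image)
  have "inj_on e (model a b d)" using e_eq_iff by (auto intro: inj_onI)
  then have inj: "inj_on (e \<circ> model_of_grid d) (grid a b)"
    using img inj_on_model_of_grid by (metis comp_inj_on)
  have "carrier L = (e \<circ> model_of_grid d) ` grid a b"
    unfolding carrier_eq img[symmetric] by (simp add: image_comp)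
  then have "row_orbit_structure L = orbit_structure (grid_row a b d) (grid a b)"
    unfolding row_orbit_structure_def
    using orbit_structure_image[OF inj grid_row_closed[OF a_pos b_pos d_less], of "rowmotion L"]
      row_model_of_grid by simp
  then show ?thesis using orbit_structure_grid_row[OF a_pos b_pos d_less] by simp
qed

end

lemma model_join_properties:
  assumes "a > 0" "d < b" and x: "x \<in> model a b d" and y: "y \<in> model a b d"
  shows "model_join d x y \<in> model a b d" "x \<le> model_join d x y" "y \<le> model_join d x y"
    "w \<in> model a b d \<Longrightarrow> x \<le> w \<Longrightarrow> y \<le> w \<Longrightarrow> model_join d x y \<le> w"
  using assms unfolding model_def model_join_def less_eq_prod_def max_def
  by (auto split: if_splits)

section \<open>The paths above a hook\<close>

abbreviation norths :: "nat \<Rightarrow> step list" where "norths n \<equiv> replicate n North"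
abbreviation easts :: "nat \<Rightarrow> step list" where "easts n \<equiv> replicate n East"

lemma count_list_replicate [simp]: "count_list (replicate n x) y = (if x = y then n else 0)"
  by (induction n) auto

text \<open>Each of the four runs contributes the part of it lying within the first \<open>k\<close>
  steps; truncated subtraction yields 0 for a run not yet reached.\<close>

lemma point_hook:
  "point (hook a b) k = (min k 1 + min (k - a) (b - 1), min (k - 1) (a - 1) + min (k - (a - 1 + b)) 1)"
  if "a > 0" "b > 0"
proof -
  have "take k (hook a b) = easts (min k 1) @ norths (min (k - 1) (a - 1)) @
    easts (min (k - a) (b - 1)) @ norths (min (k - (a - 1 + b)) 1)"
    using that unfolding hook_def
    by (cases k; cases "k - (a - 1 + b)") (auto simp: min_def Suc_diff_le)
  then show ?thesis unfolding point_def by simp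
qed

text \<open>The lowest point of the hook has height 0 over \<open>x \<le> 1\<close> and height
  \<open>a - 1\<close> over all larger \<open>x\<close>.\<close>

lemma points_hook_iff:
  assumes "a > 0" "b > 0" "x \<le> b"
  shows "(\<exists>y'\<le>y. (x, y') \<in> points (hook a b)) \<longleftrightarrow> x \<le> 1 \<or> a - 1 \<le> y"
proof
  assume "\<exists>y'\<le>y. (x, y') \<in> points (hook a b)"
  then show "x \<le> 1 \<or> a - 1 \<le> y"
    unfolding points_def by (auto simp: point_hook[OF assms(1,2)] min_def split: if_splits)
next
  have len: "length (hook a b) = a + b" using assms unfolding hook_def by simp
  have "(0, 0) \<in> points (hook a b)" "(1, 0) \<in> points (hook a b)"
    unfolding points_def
     apply (rule image_eqI[where x = 0], simp add: point_hook[OF assms(1,2)], simp)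
    apply (rule image_eqI[where x = 1])
    using assms len by (simp_all add: point_hook)
  moreover have "(x, a - 1) \<in> points (hook a b)" if "x > 1"
    unfolding points_def
    apply (rule image_eqI[where x = "a - 1 + x"])
    using assms len that by (simp_all add: point_hook)
  moreover assume "x \<le> 1 \<or> a - 1 \<le> y"
  moreover have "x = 0 \<or> x = 1 \<or> x > 1" by linarith
  ultimately show "\<exists>y'\<le>y. (x, y') \<in> points (hook a b)"
    using le0 leD by blast
qed

text \<open>Phrased with prefixes, the condition can be applied directly to words built by
  concatenation: no second east step below height \<open>a - 1\<close>.\<close>

lemma nu_paths_hook_iff:
  assumes "a > 0" "b > 0"
  shows "\<mu> \<in> nu_paths (hook a b) \<longleftrightarrow> count_list \<mu> East = b \<and> count_list \<mu> North = a \<and>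
    (\<forall>u v. \<mu> = u @ v \<longrightarrow> count_list u East \<le> 1 \<or> a - 1 \<le> count_list u North)"
proof (cases "count_list \<mu> East = b \<and> count_list \<mu> North = a")
  case True
  have "weakly_above \<mu> (hook a b) \<longleftrightarrow>
    (\<forall>x y. (x, y) \<in> points \<mu> \<longrightarrow> x \<le> 1 \<or> a - 1 \<le> y)"
  proof -
    have "x \<le> b" if "(x, y) \<in> points \<mu>" for x y
    proof -
      obtain k where "x = count_list (take k \<mu>) East" using \<open>(x, y) \<in> points \<mu>\<close>
        unfolding points_def point_def by auto
      then show ?thesis using True by (metis append_take_drop_id count_list_append le_add1)
    qed
    then show ?thesis unfolding weakly_above_def using points_hook_iff[OF assms] by meson
  qed
  also have "\<dots> \<longleftrightarrow> (\<forall>u v. \<mu> = u @ v \<longrightarrow> count_list u East \<le> 1 \<or> a - 1 \<le> count_list u North)"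
  proof
    assume *: "\<forall>x y. (x, y) \<in> points \<mu> \<longrightarrow> x \<le> 1 \<or> a - 1 \<le> y"
    show "\<forall>u v. \<mu> = u @ v \<longrightarrow> count_list u East \<le> 1 \<or> a - 1 \<le> count_list u North"
    proof (intro allI impI)
      fix u v assume "\<mu> = u @ v"
      then have "(count_list u East, count_list u North) \<in> points \<mu>"
        unfolding points_def point_def by (intro image_eqI[where x = "length u"]) auto
      then show "count_list u East \<le> 1 \<or> a - 1 \<le> count_list u North" using * by blast
    qed
  next
    assume *: "\<forall>u v. \<mu> = u @ v \<longrightarrow> count_list u East \<le> 1 \<or> a - 1 \<le> count_list u North"
    show "\<forall>x y. (x, y) \<in> points \<mu> \<longrightarrow> x \<le> 1 \<or> a - 1 \<le> y"
      unfolding points_def point_def using * append_take_drop_id by (metis (no_types, lifting) image_iff prod.inject)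
  qed
  finally show ?thesis using True assms
    unfolding nu_paths_def hook_def point_def by auto
next
  case False
  then show ?thesis using assms unfolding nu_paths_def hook_def point_def by auto
qed

lemma eq_replicate_if_count_0:
  assumes "count_list xs North = 0"
  shows "xs = easts (count_list xs East)"
  using assms
proof (induction xs)
  case (Cons x xs)
  then show ?case by (cases x) simp_all
qed simp

lemma one_north:
  assumes "count_list xs North = 1" "count_list xs East = n"
  shows "\<exists>k\<le>n. xs = easts k @ North # easts (n - k)"
proof -
  have "North \<in> set xs" using assms(1) by (metis count_list_0_iff zero_neq_one)
  then obtain u v where uv: "xs = u @ North # v" using split_list by fast
  then have "count_list u North = 0" "count_list v North = 0" using assms by auto
  then have "u = easts (count_list u East)" "v = easts (count_list v East)"
    by (intro eq_replicate_if_count_0; simp)+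
  moreover have "count_list u East + count_list v East = n" using uv assms by simp
  ultimately show ?thesis using uv by (metis add_diff_cancel_left' le_add1)
qed

lemma split_norths: "\<exists>n ys. xs = norths n @ ys \<and> (ys = [] \<or> (\<exists>zs. ys = East # zs))"
proof (induction xs)
  case (Cons x xs)
  show ?case
  proof (cases x)
    case North
    then show ?thesis using Cons by (metis append_Cons replicate_Suc)
  qed (auto intro: exI[of _ 0])
qed auto

definition grid_path :: "nat \<Rightarrow> nat \<Rightarrow> nat \<Rightarrow> nat \<Rightarrow> step list" where
  "grid_path a b i j = norths (a - 1 - i) @ East # norths i @ easts j @ North # easts (b - 1 - j)"

text \<open>Row 0: no east step below height \<open>a - 1\<close>, which leaves \<open>b + 1\<close>
  positions for the last north step.\<close>

definition tail_path :: "nat \<Rightarrow> nat \<Rightarrow> nat \<Rightarrow> step list" where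
  "tail_path a b r = norths (a - 1) @ easts r @ North # easts (b - r)"

lemma nu_paths_hook:
  assumes "a > 0" "b > 0"
  shows "nu_paths (hook a b) = tail_path a b ` {..b} \<union> {grid_path a b i j |i j. 0 < i \<and> i < a \<and> j < b}"
proof (intro equalityI subsetI)
  fix \<mu> assume "\<mu> \<in> nu_paths (hook a b)"
  then have E: "count_list \<mu> East = b" and N: "count_list \<mu> North = a"
    and pre: "\<And>u v. \<mu> = u @ v \<Longrightarrow> count_list u East \<le> 1 \<or> a - 1 \<le> count_list u North"
    unfolding nu_paths_hook_iff[OF assms] by blast+
  obtain h ys where ys: "\<mu> = norths h @ ys" "ys = [] \<or> (\<exists>zs. ys = East # zs)"
    using split_norths by blast
  show "\<mu> \<in> tail_path a b ` {..b} \<union> {grid_path a b i j |i j. 0 < i \<and> i < a \<and> j < b}"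
  proof (cases "h \<ge> a - 1")
    case True
    define zs where "zs = norths (h - (a - 1)) @ ys"
    have mu: "\<mu> = norths (a - 1) @ zs"
      unfolding ys zs_def append_assoc[symmetric] replicate_add[symmetric] using True by simp
    have "count_list zs North = 1" "count_list zs East = b" using E N assms unfolding mu by simp_all
    then show ?thesis using one_north[of zs b] unfolding mu tail_path_def by auto
  next
    case False
    obtain zs where zs: "ys = East # zs" using ys E assms by auto
    obtain k ws where ws: "zs = norths k @ ws" "ws = [] \<or> (\<exists>vs. ws = East # vs)"
      using split_norths by blast
    define i where "i = a - 1 - h"
    \<comment> \<open>Otherwise a second east step would occur below height
      \<open>a - 1\<close>.\<close>
    have "i \<le> k"
    proof (rule ccontr)
      assume less: "\<not> i \<le> k"
      then obtain vs where "ws = East # vs" using ws N False unfolding ys zs i_def by auto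
      then have "\<mu> = (norths h @ East # norths k @ [East]) @ vs" unfolding ys zs ws by simp
      from pre[OF this] show False using less unfolding i_def by simp
    qed
    define vs where "vs = norths (k - i) @ ws"
    have "zs = norths i @ vs"
      unfolding ws vs_def append_assoc[symmetric] replicate_add[symmetric] using \<open>i \<le> k\<close> by simp
    then have mu: "\<mu> = norths h @ East # norths i @ vs" unfolding ys zs by simp
    have "count_list vs North = 1" "count_list vs East = b - 1"
      using E N False assms unfolding mu i_def by simp_all
    then obtain j where "j \<le> b - 1" "vs = easts j @ North # easts (b - 1 - j)" using one_north by blast
    then have "\<mu> = grid_path a b i j \<and> 0 < i \<and> i < a \<and> j < b"
      using False assms unfolding mu grid_path_def i_def by auto
    then show ?thesis by blast
  qed
next
  fix \<mu> assume "\<mu> \<in> tail_path a b ` {..b} \<union> {grid_path a b i j |i j. 0 < i \<and> i < a \<and> j < b}"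
  then have "count_list \<mu> East = b \<and> count_list \<mu> North = a \<and>
    (\<exists>p q. \<mu> = p @ q \<and> count_list p East \<le> 1 \<and> count_list p North = a - 1)"
  proof
    assume "\<mu> \<in> tail_path a b ` {..b}"
    then obtain r where "\<mu> = norths (a - 1) @ easts r @ North # easts (b - r)" "r \<le> b"
      unfolding tail_path_def by blast
    moreover from this have "count_list \<mu> East = b \<and> count_list \<mu> North = a" using assms by simp
    ultimately show ?thesis by (intro conjI exI[of _ "norths (a - 1)"] exI) simp_all
  next
    assume "\<mu> \<in> {grid_path a b i j |i j. 0 < i \<and> i < a \<and> j < b}"
    then obtain i j where ij: "\<mu> = grid_path a b i j" "0 < i" "i < a" "j < b" by blast
    have "\<mu> = (norths (a - 1 - i) @ East # norths i) @ easts j @ North # easts (b - 1 - j)"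
      unfolding ij(1) grid_path_def by simp
    moreover have "count_list (norths (a - 1 - i) @ East # norths i) East \<le> 1"
      "count_list (norths (a - 1 - i) @ East # norths i) North = a - 1" using ij by simp_all
    moreover have "count_list \<mu> East = b \<and> count_list \<mu> North = a"
      using ij unfolding grid_path_def by simp
    ultimately show ?thesis by blast
  qed
  then obtain p q where pq: "\<mu> = p @ q" "count_list p East \<le> 1" "count_list p North = a - 1"
    and *: "count_list \<mu> East = b" "count_list \<mu> North = a" by blast
  \<comment> \<open>A prefix \<open>u\<close> is comparable with \<open>p\<close>: if shorter, it
    has at most one east step, and if longer, at least \<open>a - 1\<close> north steps.\<close>
  have "count_list u East \<le> 1 \<or> a - 1 \<le> count_list u North" if "\<mu> = u @ v" for u v
    using that pq unfolding pq(1) append_eq_append_conv2 by auto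
  then show "\<mu> \<in> nu_paths (hook a b)" unfolding nu_paths_hook_iff[OF assms] using * by blast
qed

text \<open>The first east step lies in run 0; the others stand at positions \<open>a\<close> to
  \<open>a + b - 2\<close>, after exactly \<open>a - 1\<close> north steps.\<close>

lemma east_run_hook:
  assumes "a > 0" "b > 0" "i > 0"
  shows "east_run (hook a b) i \<le> (if i = a - 1 then b - 1 else 0)"
proof -
  define S where "S = {k. k < length (hook a b) \<and> hook a b ! k = East \<and>
    count_list (take k (hook a b)) North = i}"
  have "k \<in> {a..<a + b - 1} \<and> i = a - 1" if "k \<in> S" for k
  proof -
    have k: "k < a + b" "hook a b ! k = East" and c: "count_list (take k (hook a b)) North = i"
      using that assms unfolding S_def by (auto simp: hook_def)
    have ci: "i = min (k - 1) (a - 1) + min (k - (a - 1 + b)) 1"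
      using point_hook[OF assms(1,2), of k] c unfolding point_def by simp
    then have "k \<ge> a" using k assms unfolding hook_def by (cases k) (auto simp: nth_append split: if_splits)
    moreover have "k \<noteq> a + b - 1"
      using k assms unfolding hook_def by (cases k) (auto simp: nth_append split: if_splits)
    ultimately show ?thesis using k ci assms by auto
  qed
  then have "S \<subseteq> (if i = a - 1 then {a..<a + b - 1} else {})" by auto
  then have "card S \<le> card (if i = a - 1 then {a..<a + b - 1} else {})" by (rule card_mono[rotated]) simp
  then show ?thesis unfolding east_run_def S_def[symmetric] by (auto split: if_splits)
qed

section \<open>Rotations\<close>

text \<open>Altitude is measured from the start of \<open>s\<close>, so that an excursion can be
  studied apart from the path containing it.\<close>

definition first_return :: "(nat \<Rightarrow> int) \<Rightarrow> step list \<Rightarrow> bool" where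
  "first_return \<delta> s \<longleftrightarrow> alt \<delta> s (length s) = 0 \<and> (\<forall>k. 0 < k \<and> k < length s \<longrightarrow> alt \<delta> s k \<noteq> 0)"

lemma alt_append: "k \<le> length xs \<Longrightarrow> alt \<delta> (xs @ ys) k = alt \<delta> xs k"
  by (induction k) (auto simp: nth_append split: step.split)

text \<open>Increments are indexed by the north steps of the whole path, so cutting off
  \<open>xs\<close> shifts the index by the north steps of \<open>xs\<close>.\<close>

lemma alt_append_shift:
  "k \<le> length ys \<Longrightarrow> alt \<delta> (xs @ ys) (length xs + k) =
     alt \<delta> xs (length xs) + alt (\<lambda>i. \<delta> (count_list xs North + i)) ys k"
  by (induction k) (auto simp: nth_append alt_append split: step.split)

lemma alt_Cons_North: "k \<le> length xs \<Longrightarrow> alt \<delta> (North # xs) (Suc k) = \<delta> 1 + alt (\<lambda>i. \<delta> (1 + i)) xs k"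
  using alt_append_shift[of k xs \<delta> "[North]"] by simp

lemma alt_easts: "k \<le> n \<Longrightarrow> alt \<delta> (easts n @ xs) k = - int k"
  by (induction k) (auto simp: nth_append)

lemma alt_easts_append:
  "n \<le> k \<Longrightarrow> k \<le> n + length xs \<Longrightarrow> alt \<delta> (easts n @ xs) k = alt \<delta> xs (k - n) - int n"
  using alt_append_shift[of "k - n" xs \<delta> "easts n"] alt_easts[of n n \<delta> "easts n"]
    alt_append[of n "easts n" \<delta> "easts n"] by simp

text \<open>Fixing the prefix \<open>u\<close> selects one valley; a rotation there has at most one
  result.\<close>

definition rotation_at :: "(nat \<Rightarrow> int) \<Rightarrow> step list \<Rightarrow> step list \<Rightarrow> step list \<Rightarrow> bool" where
  "rotation_at \<delta> u \<mu> \<mu>' \<longleftrightarrow> (\<exists>v w. \<mu> = u @ East # (North # v) @ w \<and>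
     \<mu>' = u @ (North # v) @ East # w \<and> first_return (\<lambda>i. \<delta> (count_list u North + i)) (North # v))"

lemma rotation_iff_rotation_at:
  "rotation \<delta> \<mu> \<mu>' \<longleftrightarrow> (\<exists>u. rotation_at \<delta> u \<mu> \<mu>')"
proof -
  have *: "(let i = length (u @ [East]); j = length (u @ [East] @ s) in
      alt \<delta> (u @ [East] @ s @ w) j = alt \<delta> (u @ [East] @ s @ w) i \<and>
      (\<forall>k. i < k \<and> k < j \<longrightarrow> alt \<delta> (u @ [East] @ s @ w) k \<noteq> alt \<delta> (u @ [East] @ s @ w) i))
    \<longleftrightarrow> first_return (\<lambda>i. \<delta> (count_list u North + i)) s" for u s w
  proof -
    define i where "i = length (u @ [East])"
    define A where "A = alt \<delta> (u @ [East] @ s @ w)"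
    have A: "A (i + k) = A i + alt (\<lambda>i. \<delta> (count_list u North + i)) s k" if "k \<le> length s" for k
    proof -
      have "alt \<delta> ((u @ [East]) @ (s @ w)) (length (u @ [East]) + k) =
        alt \<delta> (u @ [East]) (length (u @ [East])) +
        alt (\<lambda>i. \<delta> (count_list (u @ [East]) North + i)) (s @ w) k"
        if "k \<le> length (s @ w)"
        using that by (rule alt_append_shift)
      moreover have "A i = alt \<delta> (u @ [East]) (length (u @ [East]))"
        unfolding A_def i_def using alt_append[of i "u @ [East]" \<delta> "s @ w"] i_def by simp
      ultimately show ?thesis
        using that alt_append[of k s _ w] unfolding A_def i_def by simp
    qed
    have "(\<forall>k. i < k \<and> k < i + length s \<longrightarrow> A k \<noteq> A i) \<longleftrightarrow>
      (\<forall>k. 0 < k \<and> k < length s \<longrightarrow> A (i + k) \<noteq> A i)"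
      by (metis add_less_cancel_left add.right_neutral less_imp_add_positive)
    moreover have "length (u @ [East] @ s) = i + length s" unfolding i_def by simp
    ultimately show ?thesis
      unfolding Let_def i_def[symmetric] A_def[symmetric] first_return_def using A by auto
  qed
  have "rotation \<delta> \<mu> \<mu>' \<longleftrightarrow> (\<exists>u v w. \<mu> = u @ [East] @ (North # v) @ w \<and>
      \<mu>' = u @ (North # v) @ [East] @ w \<and> first_return (\<lambda>i. \<delta> (count_list u North + i)) (North # v))"
    unfolding rotation_def by (intro arg_cong[where f = Ex] ext conj_cong refl) (simp only: *)
  then show ?thesis unfolding rotation_at_def by simp
qed

text \<open>If two first returns begin the same word, the shorter one would be an earlier return
  inside the longer.\<close>

lemma first_return_unique:
  assumes "first_return \<delta> s" "first_return \<delta> s'" "s \<noteq> []" "s' \<noteq> []" "s @ w = s' @ w'"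
  shows "s = s' \<and> w = w'"
proof -
  have "\<not> length t < length t'"
    if "first_return \<delta> t" "first_return \<delta> t'" "t \<noteq> []" "t @ v = t' @ v'" for t t' v v'
    using that alt_append[of "length t" t \<delta> v] alt_append[of "length t" t' \<delta> v']
    unfolding first_return_def by force
  from this[OF assms(1,2,3,5)] this[OF assms(2,1,4) assms(5)[symmetric]]
  have "length s = length s'" by simp
  then show ?thesis using assms(5) by simp
qed

lemma norths_append_eq:
  "norths n @ xs = u @ East # ys \<Longrightarrow> \<exists>u'. u = norths n @ u' \<and> xs = u' @ East # ys"
proof (induction n arbitrary: u)
  case (Suc n)
  then obtain v where "u = North # v" "norths n @ xs = v @ East # ys" by (cases u) auto
  then show ?case using Suc.IH by auto
qed simp

lemma easts_valley:
  "easts n @ North # xs = u @ East # North # ys \<Longrightarrow>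
    (n > 0 \<and> u = easts (n - 1) \<and> ys = xs) \<or> (\<exists>u'. u = easts n @ North # u' \<and> xs = u' @ East # North # ys)"
proof (induction n arbitrary: u)
  case 0
  then show ?case by (cases u) auto
next
  case (Suc n)
  show ?case
  proof (cases u)
    case Nil
    then have "easts n @ North # xs = North # ys" using Suc.prems by simp
    then have "n = 0" "ys = xs" by (cases n; simp)+
    then show ?thesis using Nil by simp
  next
    case (Cons c v)
    then have v: "c = East" "easts n @ North # xs = v @ East # North # ys" using Suc.prems by auto
    show ?thesis using Suc.IH[OF v(2)] Cons v(1) by (cases n) auto
  qed
qed

lemma easts_no_valley: "easts n \<noteq> u @ East # North # ys"
  by (metis Un_iff in_set_replicate list.set_intros set_append step.distinct(1) set_subset_Cons subsetD)

section \<open>Valleys and excursions in paths above the hook\<close>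

lemma tail_valley:
  assumes "tail_path a b r = u @ East # North # ys"
  shows "r > 0 \<and> u = norths (a - 1) @ easts (r - 1) \<and> ys = easts (b - r)"
proof -
  obtain u' where u': "u = norths (a - 1) @ u'" "easts r @ North # easts (b - r) = u' @ East # North # ys"
    using norths_append_eq assms unfolding tail_path_def by blast
  then show ?thesis using easts_valley[OF u'(2)] easts_no_valley by blast
qed

text \<open>There are at most two valleys: one at the isolated first east step, and one before the
  last north step if \<open>j > 0\<close>.\<close>

lemma grid_valley:
  assumes "grid_path a b i j = u @ East # North # ys" "i > 0"
  shows "(u = norths (a - 1 - i) \<and> ys = norths (i - 1) @ easts j @ North # easts (b - 1 - j)) \<or>
    (j > 0 \<and> u = norths (a - 1 - i) @ East # norths i @ easts (j - 1) \<and> ys = easts (b - 1 - j))"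
proof -
  obtain u' where u': "u = norths (a - 1 - i) @ u'"
    "East # norths i @ easts j @ North # easts (b - 1 - j) = u' @ East # North # ys"
    using norths_append_eq assms unfolding grid_path_def by blast
  show ?thesis
  proof (cases u')
    case Nil
    then show ?thesis using u' assms(2) by (cases i) auto
  next
    case (Cons c v)
    then have "c = East" "norths i @ easts j @ North # easts (b - 1 - j) = v @ East # North # ys"
      using u' by auto
    moreover from this obtain v' where "v = norths i @ v'"
      "easts j @ North # easts (b - 1 - j) = v' @ East # North # ys" using norths_append_eq by blast
    ultimately show ?thesis using easts_valley[of j "easts (b - 1 - j)" v' ys] easts_no_valley Cons u'(1) by auto
  qed
qed

lemma first_return_North: "\<delta> 1 = 0 \<Longrightarrow> first_return \<delta> [North]"
  unfolding first_return_def by auto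

lemma first_return_Cons:
  "first_return \<delta> (x # xs) \<longleftrightarrow> alt \<delta> (x # xs) (Suc (length xs)) = 0 \<and>
    (\<forall>k < length xs. alt \<delta> (x # xs) (Suc k) \<noteq> 0)"
  unfolding first_return_def length_Cons by (metis Suc_less_eq gr0_conv_Suc zero_less_Suc)

lemma first_return_North_easts:
  assumes "\<delta> 1 = int d"
  shows "first_return \<delta> (North # easts d)"
proof -
  have "alt \<delta> (North # easts d) (Suc k) = int d - int k" if "k \<le> d" for k
    using alt_Cons_North[of k "easts d" \<delta>] alt_easts[of k d _ "easts d"] that assms
      alt_append[of k "easts d" _ "easts d"] by (simp del: alt.simps(2))
  then show ?thesis unfolding first_return_Cons by (simp del: alt.simps(2))
qed

text \<open>The second north step has increment 0, so it is passed at positive altitude without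
  changing it, and \<open>d\<close> east steps in total are still required to return.\<close>

lemma first_return_North_easts_North_easts:
  assumes d: "\<delta> 1 = int d" "\<delta> 2 = 0" and "j < d"
  shows "first_return \<delta> (North # easts j @ North # easts (d - j))" (is "first_return _ (North # ?xs)")
proof -
  have len: "length ?xs = Suc d" using assms by simp
  \<comment> \<open>The values at \<open>k = j\<close> and \<open>k = Suc j\<close> agree: the step
    between them is the second north step.\<close>
  have alt_eq: "alt \<delta> (North # ?xs) (Suc k) = (if k \<le> j then int d - int k else int (Suc d) - int k)"
    if "k \<le> Suc d" for k
  proof -
    have S: "alt \<delta> (North # ?xs) (Suc k) = int d + alt (\<lambda>i. \<delta> (1 + i)) ?xs k"
      using alt_Cons_North[of k ?xs \<delta>] len that d by (simp del: alt.simps(2))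
    show ?thesis
    proof (cases "k \<le> j")
      case True
      then show ?thesis using S alt_easts[of k j] by (simp del: alt.simps(2))
    next
      case False
      define m where "m = k - Suc j"
      have m: "k = j + Suc m" "m \<le> d - j" using False that unfolding m_def by auto
      have "alt (\<lambda>i. \<delta> (1 + i)) ?xs k = alt (\<lambda>i. \<delta> (1 + i)) (North # easts (d - j)) (Suc m) - int j"
        using alt_easts_append[of j k "North # easts (d - j)"] m len by (simp del: alt.simps(2))
      also have "alt (\<lambda>i. \<delta> (1 + i)) (North # easts (d - j)) (Suc m) = - int m"
        using alt_Cons_North[of m "easts (d - j)" "\<lambda>i. \<delta> (1 + i)"] alt_easts[of m "d - j" _ "easts (d - j)"]
          alt_append[of m "easts (d - j)" _ "easts (d - j)"] m(2) d(2)
        by (simp add: numeral_2_eq_2 del: alt.simps(2))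
      finally show ?thesis using S m False by (simp del: alt.simps(2))
    qed
  qed
  show ?thesis unfolding first_return_Cons len using \<open>j < d\<close> by (auto simp: alt_eq simp del: alt.simps(2))
qed

lemma rotation_at_valley: "rotation_at \<delta> u \<mu> \<mu>' \<Longrightarrow> \<exists>ys. \<mu> = u @ East # North # ys"
  unfolding rotation_at_def by auto

text \<open>By uniqueness of first returns, exhibiting one excursion determines the
  rotation.\<close>

lemma rotation_at_iff:
  assumes "\<mu> = u @ East # (North # v) @ w"
    and "first_return (\<lambda>i. \<delta> (count_list u North + i)) (North # v)"
  shows "rotation_at \<delta> u \<mu> \<mu>' \<longleftrightarrow> \<mu>' = u @ (North # v) @ East # w"
proof
  assume "rotation_at \<delta> u \<mu> \<mu>'"
  then obtain v' w' where s': "\<mu> = u @ East # (North # v') @ w'" "\<mu>' = u @ (North # v') @ East # w'"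
    "first_return (\<lambda>i. \<delta> (count_list u North + i)) (North # v')"
    unfolding rotation_at_def by blast
  moreover from this have "(North # v') @ w' = (North # v) @ w" using assms(1) by simp
  ultimately have "North # v' = North # v \<and> w' = w"
    using first_return_unique assms(2) by blast
  then show "\<mu>' = u @ (North # v) @ East # w" using s' by simp
next
  assume "\<mu>' = u @ (North # v) @ East # w"
  then show "rotation_at \<delta> u \<mu> \<mu>'" unfolding rotation_at_def using assms by blast
qed

lemma easts_Suc_append: "easts n @ East # xs = easts (Suc n) @ xs"
  by (simp add: replicate_app_Cons_same)

text \<open>What an increment vector of the hook amounts to: the only increment that may be nonzero
  is \<open>d\<close>.\<close>

locale hook_increment =
  fixes a b d :: nat and \<delta> :: "nat \<Rightarrow> int"
  assumes a_pos: "a > 0" and b_pos: "b > 0" and d_less: "d < b"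
    and delta_0: "\<And>i. 0 < i \<Longrightarrow> i \<le> a \<Longrightarrow> i \<noteq> a - 1 \<Longrightarrow> \<delta> i = 0"
    and delta_d: "a > 1 \<Longrightarrow> \<delta> (a - 1) = int d"
begin

text \<open>The last north step has increment 0, so its excursion is that step alone.\<close>

lemma rotation_at_last:
  assumes "count_list u North = a - 1"
  shows "rotation_at \<delta> u (u @ East # North # w) \<mu>' \<longleftrightarrow> \<mu>' = u @ North # East # w"
  using rotation_at_iff[of _ u "[]" w \<delta>] first_return_North delta_0[of a] a_pos assms by simp

lemma rotation_tail:
  assumes "r \<le> b"
  shows "rotation \<delta> (tail_path a b r) \<mu> \<longleftrightarrow> r > 0 \<and> \<mu> = tail_path a b (r - 1)"
proof -
  define u where "u = norths (a - 1) @ easts (r - 1)"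
  have "rotation \<delta> (tail_path a b r) \<mu> \<longleftrightarrow> r > 0 \<and> rotation_at \<delta> u (tail_path a b r) \<mu>"
    unfolding rotation_iff_rotation_at u_def using tail_valley rotation_at_valley by blast
  also have "\<dots> \<longleftrightarrow> r > 0 \<and> \<mu> = tail_path a b (r - 1)"
  proof (cases r)
    case (Suc k)
    have "tail_path a b r = u @ East # North # easts (b - r)"
      unfolding u_def tail_path_def Suc by (simp add: easts_Suc_append)
    moreover have "tail_path a b (r - 1) = u @ North # East # easts (b - r)"
      unfolding u_def tail_path_def using Suc assms by (simp add: Suc_diff_Suc[symmetric])
    ultimately show ?thesis using rotation_at_last[of u] Suc unfolding u_def by simp
  qed simp
  finally show ?thesis .
qed

text \<open>The first east step passes a north step of increment 0 if \<open>i > 1\<close>, which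
  only changes the row. If \<open>i = 1\<close> it also passes \<open>d\<close> east steps: for
  \<open>d \<le> j\<close> it stops before the last north step and raises the count to
  \<open>j + 1\<close>, otherwise it crosses that step and the count stays \<open>j\<close>. This is
  the origin of \<open>skip\<close>.\<close>

lemma rotation_grid:
  assumes "0 < i" "i < a" "j < b"
  shows "rotation \<delta> (grid_path a b i j) \<mu> \<longleftrightarrow>
    \<mu> = (if i = 1 then tail_path a b (skip d j) else grid_path a b (i - 1) j) \<or>
    (j > 0 \<and> \<mu> = grid_path a b i (j - 1))"
proof -
  define u where "u = norths (a - 1 - i)"
  define u' where "u' = norths (a - 1 - i) @ East # norths i @ easts (j - 1)"
  have cu: "count_list u North = a - 1 - i" and cu': "count_list u' North = a - 1"
    unfolding u_def u'_def using assms by simp_all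
  obtain k where k: "i = Suc k" using assms by (cases i) auto
  have "rotation_at \<delta> w (grid_path a b i j) \<mu> \<Longrightarrow> w = u \<or> j > 0 \<and> w = u'" for w
    unfolding u_def u'_def using grid_valley[OF _ assms(1)] rotation_at_valley by meson
  then have "rotation \<delta> (grid_path a b i j) \<mu> \<longleftrightarrow>
    rotation_at \<delta> u (grid_path a b i j) \<mu> \<or> (j > 0 \<and> rotation_at \<delta> u' (grid_path a b i j) \<mu>)"
    unfolding rotation_iff_rotation_at by blast
  moreover have "rotation_at \<delta> u' (grid_path a b i j) \<mu> \<longleftrightarrow> \<mu> = grid_path a b i (j - 1)" if j: "j > 0"
  proof -
    obtain m where m: "j = Suc m" using j by (cases j) auto
    have "grid_path a b i j = u' @ East # North # easts (b - 1 - j)"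
      unfolding u'_def grid_path_def m by (simp add: easts_Suc_append)
    moreover have "grid_path a b i (j - 1) = u' @ North # East # easts (b - 1 - j)"
      unfolding u'_def grid_path_def using m assms by (simp add: Suc_diff_Suc[symmetric])
    ultimately show ?thesis using rotation_at_last[OF cu'] by simp
  qed
  moreover have "rotation_at \<delta> u (grid_path a b i j) \<mu> \<longleftrightarrow>
    \<mu> = (if i = 1 then tail_path a b (skip d j) else grid_path a b (i - 1) j)"
  proof -
    have g: "grid_path a b i j = u @ East # North # norths k @ easts j @ North # easts (b - 1 - j)"
      unfolding u_def grid_path_def k by simp
    show ?thesis
    proof (cases "k = 0")
      case False
      have "\<delta> (count_list u North + 1) = 0" using False k assms unfolding cu by (intro delta_0) auto
      then have "rotation_at \<delta> u (grid_path a b i j) \<mu> \<longleftrightarrow>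
        \<mu> = u @ North # East # norths k @ easts j @ North # easts (b - 1 - j)"
        using rotation_at_iff[of "grid_path a b i j" u "[]"] first_return_North g by simp
      moreover have "u @ North # East # norths k @ easts j @ North # easts (b - 1 - j) = grid_path a b (i - 1) j"
      proof -
        have "a - 1 - (i - 1) = Suc (a - 1 - i)" using k assms by simp
        then show ?thesis unfolding grid_path_def u_def k by (simp add: replicate_app_Cons_same)
      qed
      ultimately show ?thesis using False k by simp
    next
      case True
      have fr1: "\<delta> (count_list u North + 1) = int d" "\<delta> (count_list u North + 2) = 0"
      proof -
        have "count_list u North + 1 = a - 1" "count_list u North + 2 = a"
          using True k assms unfolding cu by auto
        then show "\<delta> (count_list u North + 1) = int d" "\<delta> (count_list u North + 2) = 0"
          using delta_d delta_0[of a] assms by auto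
      qed
      have un: "u @ North # xs = norths (a - 1) @ xs" for xs
      proof -
        have "a - 1 = Suc (a - 1 - i)" using True k assms by simp
        then show ?thesis unfolding u_def by (simp add: replicate_app_Cons_same)
      qed
      show ?thesis
      proof (cases "j < d")
        case False
        have "grid_path a b i j = u @ East # (North # easts d) @ easts (j - d) @ North # easts (b - 1 - j)"
          unfolding g True using False by (simp flip: append_assoc replicate_add)
        then have "rotation_at \<delta> u (grid_path a b i j) \<mu> \<longleftrightarrow>
          \<mu> = u @ (North # easts d) @ East # easts (j - d) @ North # easts (b - 1 - j)"
          using fr1 by (intro rotation_at_iff first_return_North_easts)
        also have "u @ (North # easts d) @ East # easts (j - d) @ North # easts (b - 1 - j) = tail_path a b (skip d j)"
          unfolding tail_path_def skip_def using False by (simp add: un easts_Suc_append flip: append_assoc replicate_add)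
        finally show ?thesis using True k by simp
      next
        case less: True
        \<comment> \<open>Since \<open>d < b\<close>, the \<open>d - j\<close> east steps completing
          the excursion are available after the last north step.\<close>
        have "b - 1 - j = (d - j) + (b - 1 - d)" using less d_less by simp
        then have "grid_path a b i j =
          u @ East # (North # easts j @ North # easts (d - j)) @ easts (b - 1 - d)"
          unfolding g True by (simp add: replicate_add)
        then have "rotation_at \<delta> u (grid_path a b i j) \<mu> \<longleftrightarrow>
          \<mu> = u @ (North # easts j @ North # easts (d - j)) @ East # easts (b - 1 - d)"
          using fr1 less by (intro rotation_at_iff first_return_North_easts_North_easts)
        also have "u @ (North # easts j @ North # easts (d - j)) @ East # easts (b - 1 - d) = tail_path a b (skip d j)"
        proof -
          have "b - j = Suc (d - j) + (b - 1 - d)" using less d_less by simp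
          then have "easts (b - j) = easts (d - j) @ East # easts (b - 1 - d)"
            by (simp only: easts_Suc_append replicate_add)
          then show ?thesis unfolding tail_path_def skip_def using less by (simp add: un)
        qed
        finally show ?thesis using True k by simp
      qed
    qed
  qed
  ultimately show ?thesis by blast
qed

end

section \<open>The alt hook-Tamari lattice\<close>

definition unskip :: "nat \<Rightarrow> nat \<Rightarrow> nat" where
  "unskip d r = (if r < d then r else r - 1)"

lemma unskip_skip [simp]: "unskip d (skip d j) = j"
  unfolding skip_def unskip_def by simp

definition hook_path :: "nat \<Rightarrow> nat \<Rightarrow> nat \<Rightarrow> nat \<times> nat \<Rightarrow> step list" where
  "hook_path a b d x =
    (if fst x = 0 then tail_path a b (snd x) else grid_path a b (fst x) (unskip d (snd x)))"

lemma model_cases: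
  assumes "x \<in> model a b d" "d < b"
  obtains (tail) r where "x = (0, r)" "r \<le> b"
    | (grid) i j where "x = (i, skip d j)" "0 < i" "i < a" "j < b"
proof (cases "fst x = 0")
  case True
  then show thesis using assms tail[of "snd x"] unfolding model_def by (cases x) auto
next
  case False
  then have "x = (fst x, skip d (unskip d (snd x)))" "0 < fst x" "fst x < a" "unskip d (snd x) < b"
    using assms unfolding model_def skip_def unskip_def by (auto split: prod.splits)
  then show thesis by (rule grid)
qed

lemma tail_in_model: "a > 0 \<Longrightarrow> r \<le> b \<Longrightarrow> (0, r) \<in> model a b d"
  unfolding model_def by simp

lemma grid_in_model: "i < a \<Longrightarrow> j < b \<Longrightarrow> (i, skip d j) \<in> model a b d"
  unfolding model_def skip_def by auto

lemma nu_paths_hook_eq_image: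
  assumes "a > 0" "d < b"
  shows "nu_paths (hook a b) = hook_path a b d ` model a b d"
proof -
  have "hook_path a b d ` model a b d = tail_path a b ` {..b} \<union> {grid_path a b i j |i j. 0 < i \<and> i < a \<and> j < b}"
  proof (intro equalityI subsetI)
    fix \<mu> assume "\<mu> \<in> hook_path a b d ` model a b d"
    then obtain x where x: "x \<in> model a b d" "\<mu> = hook_path a b d x" by blast
    from x(1) assms(2) show "\<mu> \<in> tail_path a b ` {..b} \<union> {grid_path a b i j |i j. 0 < i \<and> i < a \<and> j < b}"
      by (cases rule: model_cases) (auto simp: x(2) hook_path_def)
  next
    fix \<mu> assume "\<mu> \<in> tail_path a b ` {..b} \<union> {grid_path a b i j |i j. 0 < i \<and> i < a \<and> j < b}"
    then consider r where "\<mu> = hook_path a b d (0, r)" "r \<le> b"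
      | i j where "\<mu> = hook_path a b d (i, skip d j)" "i < a" "j < b"
    proof (elim UnE imageE CollectE exE)
      fix r assume *: "\<And>r. \<mu> = hook_path a b d (0, r) \<Longrightarrow> r \<le> b \<Longrightarrow> thesis"
        and "\<mu> = tail_path a b r" "r \<in> {..b}"
      then show thesis using *[of r] unfolding hook_path_def by simp
    next
      fix i j assume *: "\<And>i j. \<mu> = hook_path a b d (i, skip d j) \<Longrightarrow> i < a \<Longrightarrow> j < b \<Longrightarrow> thesis"
        and "\<mu> = grid_path a b i j \<and> 0 < i \<and> i < a \<and> j < b"
      then show thesis using *[of i j] unfolding hook_path_def by simp
    qed
    then show "\<mu> \<in> hook_path a b d ` model a b d"
      using tail_in_model[OF assms(1)] grid_in_model by cases blast+
  qed
  then show ?thesis using nu_paths_hook assms by simp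
qed

text \<open>Recovers the length of an initial run, hence the coordinates of a path.\<close>

lemma takeWhile_replicate_append:
  "P x \<Longrightarrow> \<not> P y \<Longrightarrow> takeWhile P (replicate n x @ y # ys) = replicate n x"
  by (induction n) auto

lemma tail_path_inject: "tail_path a b r = tail_path a b r' \<Longrightarrow> r = r'"
proof -
  assume "tail_path a b r = tail_path a b r'"
  then have "easts r @ North # easts (b - r) = easts r' @ North # easts (b - r')"
    unfolding tail_path_def by simp
  then have "takeWhile (\<lambda>c. c = East) (easts r @ North # easts (b - r)) =
    takeWhile (\<lambda>c. c = East) (easts r' @ North # easts (b - r'))" by simp
  then show ?thesis by (simp add: takeWhile_replicate_append)
qed

lemma grid_path_norths: "takeWhile (\<lambda>c. c = North) (grid_path a b i j) = norths (a - 1 - i)"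
  unfolding grid_path_def by (rule takeWhile_replicate_append) simp_all

lemma tail_path_neq_grid_path:
  assumes "0 < i" "i < a"
  shows "tail_path a b r \<noteq> grid_path a b i j"
proof
  assume eq: "tail_path a b r = grid_path a b i j"
  then obtain u where "norths (a - 1 - i) = norths (a - 1) @ u"
    unfolding tail_path_def grid_path_def using norths_append_eq by blast
  then have "a - 1 - i = a - 1 + length u" by (metis length_append length_replicate)
  then show False using assms by simp
qed

lemma grid_path_inject:
  assumes "grid_path a b i j = grid_path a b i' j'" "i < a" "i' < a"
  shows "i = i' \<and> j = j'"
proof -
  have "norths (a - 1 - i) = norths (a - 1 - i')" using assms(1) grid_path_norths by metis
  then have i: "i = i'" using assms(2,3) by simp
  then have "easts j @ North # easts (b - 1 - j) = easts j' @ North # easts (b - 1 - j')"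
    using assms(1) unfolding grid_path_def by simp
  then have "takeWhile (\<lambda>c. c = East) (easts j @ North # easts (b - 1 - j)) =
    takeWhile (\<lambda>c. c = East) (easts j' @ North # easts (b - 1 - j'))" by simp
  then show ?thesis using i by (simp add: takeWhile_replicate_append)
qed

lemma inj_on_hook_path:
  assumes "d < b"
  shows "inj_on (hook_path a b d) (model a b d)"
proof (rule inj_onI)
  fix x y assume x: "x \<in> model a b d" and y: "y \<in> model a b d" and eq: "hook_path a b d x = hook_path a b d y"
  from x assms show "x = y"
  proof (cases rule: model_cases)
    case (tail r)
    from y assms show ?thesis
      by (cases rule: model_cases)
        (use eq tail tail_path_inject tail_path_neq_grid_path in \<open>auto simp: hook_path_def\<close>)
  next
    case (grid i j)
    from y assms show ?thesis
    proof (cases rule: model_cases)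
      case (tail r)
      then show ?thesis
        using eq grid tail_path_neq_grid_path[of i a b r j] unfolding hook_path_def by simp
    next
      case grid': (grid i' j')
      then show ?thesis
        using eq grid grid_path_inject[of a b i j i' j'] unfolding hook_path_def by simp
    qed
  qed
qed

section \<open>Reachability by rotations is the reversed componentwise order\<close>

context hook_increment
begin

abbreviation path :: "nat \<times> nat \<Rightarrow> step list" where
  "path \<equiv> hook_path a b d"

abbreviation rot :: "step list \<Rightarrow> step list \<Rightarrow> bool" where
  "rot \<equiv> \<lambda>\<mu> \<mu>'. \<mu> \<in> nu_paths (hook a b) \<and> \<mu>' \<in> nu_paths (hook a b) \<and> rotation \<delta> \<mu> \<mu>'"

lemma path_in: "x \<in> model a b d \<Longrightarrow> path x \<in> nu_paths (hook a b)"
  using nu_paths_hook_eq_image[OF a_pos d_less] by blast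

lemma rot_pathI:
  "x \<in> model a b d \<Longrightarrow> y \<in> model a b d \<Longrightarrow> rotation \<delta> (path x) (path y) \<Longrightarrow> rot (path x) (path y)"
  using path_in by simp

lemma rotation_decreases:
  assumes "x \<in> model a b d" "rotation \<delta> (path x) \<mu>"
  shows "\<exists>y\<in>model a b d. \<mu> = path y \<and> y \<le> x"
  using assms(1) d_less
proof (cases rule: model_cases)
  case (tail r)
  then have "\<mu> = path (0, r - 1)"
    using assms(2) rotation_tail unfolding hook_path_def by simp
  then show ?thesis
    using tail tail_in_model[OF a_pos, of "r - 1" b d] by (intro bexI[of _ "(0, r - 1)"]) auto
next
  case (grid i j)
  then have "rotation \<delta> (grid_path a b i j) \<mu>" using assms(2) unfolding hook_path_def by simp
  then consider "\<mu> = (if i = 1 then tail_path a b (skip d j) else grid_path a b (i - 1) j)"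
    | "j > 0" "\<mu> = grid_path a b i (j - 1)" using rotation_grid grid by blast
  then show ?thesis
  proof cases
    case 1
    then have "\<mu> = path (i - 1, skip d j)" using grid unfolding hook_path_def by auto
    then show ?thesis
      using grid grid_in_model[of "i - 1" a j b d] by (intro bexI[of _ "(i - 1, skip d j)"]) auto
  next
    case 2
    then have "\<mu> = path (i, skip d (j - 1))" using grid unfolding hook_path_def by simp
    moreover have "skip d (j - 1) \<le> skip d j" unfolding skip_def by auto
    ultimately show ?thesis
      using grid grid_in_model[of i a "j - 1" b d] by (intro bexI[of _ "(i, skip d (j - 1))"]) auto
  qed
qed

lemma rot_tail: "r' \<le> r \<Longrightarrow> r \<le> b \<Longrightarrow> rot\<^sup>*\<^sup>* (path (0, r)) (path (0, r'))"
proof (induction r rule: dec_induct)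
  case (step r)
  then have "rot (path (0, Suc r)) (path (0, r))"
    by (intro rot_pathI tail_in_model a_pos) (simp_all add: hook_path_def rotation_tail)
  then show ?case
    by (rule converse_rtranclp_into_rtranclp[where r = rot]) (use step in simp)
qed simp

lemma rot_grid:
  assumes "0 < i" "i < a"
  shows "j' \<le> j \<Longrightarrow> j < b \<Longrightarrow> rot\<^sup>*\<^sup>* (path (i, skip d j)) (path (i, skip d j'))"
proof (induction j rule: dec_induct)
  case (step j)
  then have "rot (path (i, skip d (Suc j))) (path (i, skip d j))"
    using assms by (intro rot_pathI grid_in_model) (simp_all add: hook_path_def rotation_grid)
  then show ?case
    by (rule converse_rtranclp_into_rtranclp[where r = rot]) (use step in simp)
qed simp

text \<open>Because of \<open>skip\<close>, the second coordinate stays constant even on the step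
  from row 1 into row 0.\<close>

lemma rot_column:
  "i' \<le> i \<Longrightarrow> i < a \<Longrightarrow> j < b \<Longrightarrow> rot\<^sup>*\<^sup>* (path (i, skip d j)) (path (i', skip d j))"
proof (induction i rule: dec_induct)
  case (step i)
  then have "rot (path (Suc i, skip d j)) (path (i, skip d j))"
    by (intro rot_pathI grid_in_model) (simp_all add: hook_path_def rotation_grid)
  then show ?case
    by (rule converse_rtranclp_into_rtranclp[where r = rot]) (use step in simp)
qed simp

lemma rot_if_le:
  assumes x: "x \<in> model a b d" and y: "y \<in> model a b d" and le: "y \<le> x"
  shows "rot\<^sup>*\<^sup>* (path x) (path y)"
  using x d_less
proof (cases rule: model_cases)
  case (tail r)
  then show ?thesis using le rot_tail[of "snd y" r] by (cases y) simp
next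
  case x: (grid i j)
  from y d_less show ?thesis
  proof (cases rule: model_cases)
    case (tail r)
    \<comment> \<open>The row is left first: the target may be \<open>(0, d)\<close>, whose second
      coordinate occurs only in row 0.\<close>
    have "skip d j \<le> b" using x unfolding skip_def by auto
    then have "rot\<^sup>*\<^sup>* (path (0, skip d j)) (path (0, r))" using rot_tail le x tail by simp
    then show ?thesis using rot_column[of 0 i j] x tail by simp
  next
    case (grid i' j')
    then have "i' \<le> i" "j' \<le> j" using le x unfolding skip_def by (auto split: if_splits)
    then have "rot\<^sup>*\<^sup>* (path (i, skip d j)) (path (i', skip d j))"
      "rot\<^sup>*\<^sup>* (path (i', skip d j)) (path (i', skip d j'))"
      using rot_column rot_grid x grid by blast+
    then show ?thesis using x grid by simp
  qed
qed

text \<open>Each rotation lowers the coordinates, so whatever is reachable lies below; injectivity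
  of \<open>hook_path\<close> then identifies the point reached with \<open>y\<close>.\<close>

lemma rot_iff_le:
  assumes x: "x \<in> model a b d" and y: "y \<in> model a b d"
  shows "rot\<^sup>*\<^sup>* (path x) (path y) \<longleftrightarrow> y \<le> x"
proof
  have "\<exists>z\<in>model a b d. \<mu> = path z \<and> z \<le> x" if "rot\<^sup>*\<^sup>* (path x) \<mu>" for \<mu>
    using that
  proof (induction rule: rtranclp_induct)
    case base
    then show ?case using x by blast
  next
    case (step \<mu> \<mu>')
    then obtain z where z: "z \<in> model a b d" "\<mu> = path z" "z \<le> x" by blast
    then obtain y where "y \<in> model a b d" "\<mu>' = path y" "y \<le> z"
      using rotation_decreases[of z \<mu>'] step.hyps(2) by blast
    then show ?case using z(3) order_trans by blast
  qed
  moreover assume "rot\<^sup>*\<^sup>* (path x) (path y)"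
  ultimately obtain z where z: "z \<in> model a b d" "path y = path z" "z \<le> x" by blast
  have "y = z" using inj_on_hook_path[OF d_less] z(2) y z(1) by (rule inj_onD)
  then show "y \<le> x" using z(3) by simp
qed (rule rot_if_le[OF x y])

lemma hook_lattice: "hook_lattice (alt_hook_Tamari \<delta> a b) path a b d"
proof
  show "carrier (alt_hook_Tamari \<delta> a b) = path ` model a b d"
    unfolding alt_hook_Tamari_def alt_Tamari_def using nu_paths_hook_eq_image[OF a_pos d_less] by simp
  show "eq (alt_hook_Tamari \<delta> a b) = (=)"
    unfolding alt_hook_Tamari_def alt_Tamari_def by simp
  show "path x \<sqsubseteq>\<^bsub>alt_hook_Tamari \<delta> a b\<^esub> path y \<longleftrightarrow> y \<le> x"
    if "x \<in> model a b d" "y \<in> model a b d" for x y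
    unfolding alt_hook_Tamari_def alt_Tamari_def using rot_iff_le[OF that] by simp
  show "(0, 0) \<in> model a b d" unfolding model_def using a_pos by simp
  show "(0, 0) \<le> x" for x :: "nat \<times> nat" by (cases x) simp
qed (fact model_join_properties[OF a_pos d_less] b_pos d_less)+

end

lemma row_orbit_structure_alt_hook_Tamari:
  assumes "a > 0" "b > 0" "increment_vector (hook a b) \<delta>"
  shows "row_orbit_structure (alt_hook_Tamari \<delta> a b) =
    replicate_mset (gcd a b - 1) (lcm a b) + {#lcm a b + 1#}"
proof -
  have "count_list (hook a b) North = a" using assms(1) unfolding hook_def by simp
  then have inc: "0 \<le> \<delta> i \<and> \<delta> i \<le> int (east_run (hook a b) i)" if "0 < i" "i \<le> a" for i
    using assms(3) that unfolding increment_vector_def by auto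
  \<comment> \<open>For \<open>a = 1\<close> the value \<open>\<delta> (a - 1) = \<delta> 0\<close> is unconstrained and never used.\<close>
  define d where "d = (if a > 1 then nat (\<delta> (a - 1)) else 0)"
  interpret hook_increment a b d \<delta>
  proof
    show "\<delta> i = 0" if "0 < i" "i \<le> a" "i \<noteq> a - 1" for i
      using inc[of i] east_run_hook[OF assms(1,2), of i] that by simp
    show "\<delta> (a - 1) = int d" if "a > 1" using inc[of "a - 1"] that unfolding d_def by simp
    have "\<delta> (a - 1) \<le> int (b - 1)" if "a > 1"
      using inc[of "a - 1"] east_run_hook[OF assms(1,2), of "a - 1"] that by simp
    then show "d < b" using assms(2) unfolding d_def by auto
  qed (use assms in auto)
  show ?thesis by (rule hook_lattice.row_orbit_structure_eq[OF hook_lattice])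
qed

theorem theorem3p5:
  fixes a b :: nat
  assumes "a > 0" and "b > 0"
  shows "(\<forall>\<delta> \<delta>'. increment_vector (hook a b) \<delta> \<longrightarrow> increment_vector (hook a b) \<delta>' \<longrightarrow>
            row_orbit_structure (alt_hook_Tamari \<delta> a b) =
            row_orbit_structure (alt_hook_Tamari \<delta>' a b)) \<and>
         (\<forall>\<delta>. increment_vector (hook a b) \<delta> \<longrightarrow>
            row_orbit_structure (alt_hook_Tamari \<delta> a b) =
              replicate_mset (gcd a b - 1) (lcm a b) + {#lcm a b + 1#})"
  using assms row_orbit_structure_alt_hook_Tamari by simp

end
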